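(* Let $X$ be a real Banach lattice equipped with a sufficiently rich topology $\tau$. (1) If $K\subseteq X_+$ is $\tau$-compact and $\overline{\operatorname{ch}(K)}^\tau$ is $\tau$-compact, then $\operatorname{oep}\big(\overline{\operatorname{sch}(K)}^\tau\big)\subseteq K$. (2) If $K\subseteq X_+$ is weakly compact, then $\operatorname{oep}(\overline{\operatorname{sch}}(K))\subseteq K$. (3) If $K\subseteq X$ is norm compact, then $\operatorname{oep}(\overline{\operatorname{sch}}(K))\subseteq |K|$, where $|K|=\{|x|:x\in K\}$.
   Context: A locally convex Hausdorff topology $\tau$ on a Banach lattice $X$ is called sufficiently rich if (i) the space $X^\tau$ of $\tau$-continuous linear functionals on $X$ is a Banach lattice (with lattice operations given by the Riesz–Kantorovich formulas), and (ii) $X_+$ is $\tau$-closed. $\operatorname{ch}(S)$ is the convex hull; a set $C$ is solid if $x\in X$, $z\in C$, $|x|\le|z|$ imply $x\in C$; $\operatorname{sch}(S)$ is the smallest convex solid set containing $S$; $\overline{\,\cdot\,}^\tau$ denotes $\tau$-closure and $\overline{\operatorname{sch}}(S)$ the norm (equivalently weak) closure of $\operatorname{sch}(S)$. $\operatorname{oep}(A)$ is the set of order extreme points of $A$: $a\in A$ with the property that for all $x_0,x_1\in A$ and $t\in(0,1)$, $a\le(1-t)x_0+tx_1$ implies $x_0=a=x_1$. *)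

theory Defs
  imports "HOL-Analysis.Analysis"
begin

definition labs :: "'a::{lattice,uminus} \<Rightarrow> 'a" where
  "labs x = sup x (- x)"

class banach_lattice = banach + ordered_real_vector + lattice +
  assumes lattice_norm: "sup x (- x) \<le> sup y (- y) \<Longrightarrow> norm x \<le> norm y"

definition lc_hausdorff_topology :: "'a::real_vector topology \<Rightarrow> bool" where
  "lc_hausdorff_topology T \<longleftrightarrow>
     topspace T = UNIV \<and> Hausdorff_space T \<and>
     continuous_map (prod_topology T T) T (\<lambda>(x, y). x + y) \<and>
     continuous_map (prod_topology euclideanreal T) T (\<lambda>(c, x). c *\<^sub>R x) \<and>
     (\<forall>U. openin T U \<and> 0 \<in> U \<longrightarrow> (\<exists>V. openin T V \<and> convex V \<and> 0 \<in> V \<and> V \<subseteq> U))"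

definition tdual :: "'a::real_vector topology \<Rightarrow> ('a \<Rightarrow> real) set" where
  "tdual T = {f. linear f \<and> continuous_map T euclideanreal f}"

text \<open>Riesz--Kantorovich supremum of two functionals, on the positive cone.\<close>

definition RK_set :: "('a::{real_vector,order} \<Rightarrow> real) \<Rightarrow> ('a \<Rightarrow> real) \<Rightarrow> 'a \<Rightarrow> real set" where
  "RK_set f g x = {f y + g (x - y) | y. 0 \<le> y \<and> y \<le> x}"

definition RK_sup :: "('a::{real_vector,order} \<Rightarrow> real) \<Rightarrow> ('a \<Rightarrow> real) \<Rightarrow> 'a \<Rightarrow> real" where
  "RK_sup f g x = Sup (RK_set f g x)"

definition RK_abs :: "('a::{real_vector,order} \<Rightarrow> real) \<Rightarrow> 'a \<Rightarrow> real" where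
  "RK_abs f x = RK_sup f (\<lambda>z. - f z) x"

text \<open>The set F of functionals is a vector lattice under the Riesz--Kantorovich
  operations (order: pointwise on the positive cone): the suprema exist and
  are realised by an element of F.\<close>

definition RK_vector_lattice :: "('a::{real_vector,order} \<Rightarrow> real) set \<Rightarrow> bool" where
  "RK_vector_lattice F \<longleftrightarrow>
     (\<forall>f\<in>F. \<forall>g\<in>F. (\<forall>x\<ge>0. bdd_above (RK_set f g x)) \<and>
        (\<exists>h\<in>F. \<forall>x\<ge>0. h x = RK_sup f g x))"

definition RK_banach_lattice :: "('a::{real_vector,order} \<Rightarrow> real) set \<Rightarrow> bool" where
  "RK_banach_lattice F \<longleftrightarrow> RK_vector_lattice F \<and>
     (\<exists>N :: ('a \<Rightarrow> real) \<Rightarrow> real.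
        (\<forall>f\<in>F. N f \<ge> 0 \<and> (N f = 0 \<longleftrightarrow> f = (\<lambda>_. 0))) \<and>
        (\<forall>f\<in>F. \<forall>c. N (\<lambda>x. c * f x) = \<bar>c\<bar> * N f) \<and>
        (\<forall>f\<in>F. \<forall>g\<in>F. N (\<lambda>x. f x + g x) \<le> N f + N g) \<and>
        (\<forall>f\<in>F. \<forall>g\<in>F. (\<forall>x\<ge>0. RK_abs f x \<le> RK_abs g x) \<longrightarrow> N f \<le> N g) \<and>
        (\<forall>s :: nat \<Rightarrow> ('a \<Rightarrow> real). (\<forall>n. s n \<in> F) \<and>
            (\<forall>e>0. \<exists>M. \<forall>m\<ge>M. \<forall>n\<ge>M. N (\<lambda>x. s m x - s n x) < e) \<longrightarrow>
            (\<exists>f\<in>F. (\<lambda>n. N (\<lambda>x. s n x - f x)) \<longlonglongrightarrow> 0)))"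

definition sufficiently_rich :: "'a::banach_lattice topology \<Rightarrow> bool" where
  "sufficiently_rich T \<longleftrightarrow> lc_hausdorff_topology T \<and>
     RK_banach_lattice (tdual T) \<and> closedin T {x. 0 \<le> x}"

definition solid :: "'a::{lattice,uminus} set \<Rightarrow> bool" where
  "solid C \<longleftrightarrow> (\<forall>x z. z \<in> C \<and> labs x \<le> labs z \<longrightarrow> x \<in> C)"

definition sch :: "'a::{real_vector,lattice} set \<Rightarrow> 'a set" where
  "sch S = \<Inter> {C. convex C \<and> solid C \<and> S \<subseteq> C}"

definition oep :: "'a::{real_vector,order} set \<Rightarrow> 'a set" where
  "oep A = {a \<in> A. \<forall>x0\<in>A. \<forall>x1\<in>A. \<forall>t. 0 < t \<and> t < 1 \<and>
              a \<le> (1 - t) *\<^sub>R x0 + t *\<^sub>R x1 \<longrightarrow> x0 = a \<and> x1 = a}"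

definition weak_top :: "'a::real_normed_vector topology" where
  "weak_top = topology_generated_by
     {f -` U | f U. bounded_linear (f :: 'a \<Rightarrow> real) \<and> open U}"

end

theory Submission
  imports Defs
begin

text \<open>
  Let \<open>C\<close> be the closed convex hull of \<open>K\<close>, assumed compact. Every point of \<open>sch K\<close> lies below a point
  of \<open>convex hull K\<close>, and since \<open>C\<close> is compact and the positive cone closed, every point of the closure
  lies below a point of \<open>C\<close>. An order extreme point \<open>a \<le> z \<in> C\<close> therefore equals \<open>z\<close>, so it is an
  extreme point of \<open>C\<close>, and Milman's theorem puts it in \<open>K\<close>. For the weak topology the compactness
  of \<open>C\<close> is Krein's theorem: if the pointwise closure of the hull in the algebraic dual of
  \<open>X\<^sup>*\<close> contained an element not represented by a vector, Helly's lemma would give functionals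
  \<open>f m\<close> in the unit ball and \<open>z n\<close> in the hull with \<open>f m (z n) = 0\<close> for \<open>n < m\<close> but
  \<open>f m (z n) \<ge> \<theta> > 0\<close> for \<open>m \<le> n\<close>. On a weakly compact part of \<open>K\<close> a subsequence of the \<open>f m\<close>
  converges pointwise, and Simons' argument (replacing dominated convergence) turns this into
  uniformly small one-sided bounds for convex combinations, contradicting the gap. A norm
  compact \<open>K\<close> may be replaced by the weakly compact set \<open>labs ` K\<close>, which has the same \<open>sch\<close>.
\<close>

section \<open>The Hahn--Banach theorem\<close>

definition sublinear :: "('a::real_vector \<Rightarrow> real) \<Rightarrow> bool" where
  "sublinear p \<longleftrightarrow> (\<forall>x y. p (x + y) \<le> p x + p y) \<and> (\<forall>c\<ge>0. \<forall>x. p (c *\<^sub>R x) = c * p x)"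

lemma sublinear_add: "sublinear p \<Longrightarrow> p (x + y) \<le> p x + p y"
  and sublinear_scale: "sublinear p \<Longrightarrow> 0 \<le> c \<Longrightarrow> p (c *\<^sub>R x) = c * p x"
  by (auto simp: sublinear_def)

text \<open>The scaling inequality applied with \<open>inverse c\<close> yields its own converse, so
  one-sided estimates suffice, which suits functionals defined as infima.\<close>

lemma sublinearI:
  assumes add: "\<And>x y. p (x + y) \<le> p x + p y"
    and scale: "\<And>c x. 0 < c \<Longrightarrow> p (c *\<^sub>R x) \<le> c * p x"
    and zero: "p 0 = 0"
  shows "sublinear p"
  unfolding sublinear_def
proof (intro conjI allI impI add)
  fix c :: real and x assume "0 \<le> c"
  show "p (c *\<^sub>R x) = c * p x"
  proof (cases "c = 0")
    case False
    with \<open>0 \<le> c\<close> have c: "0 < c" by simp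
    have "p (inverse c *\<^sub>R (c *\<^sub>R x)) \<le> inverse c * p (c *\<^sub>R x)"
      using c by (intro scale) simp
    then have "c * p x \<le> p (c *\<^sub>R x)" using c by (simp add: field_simps)
    with scale[OF c] show ?thesis by (meson order_antisym)
  qed (simp add: zero)
qed

lemma sublinear_zero: "sublinear p \<Longrightarrow> p 0 = 0"
  using sublinear_scale[of p 0 0] by simp

lemma sublinear_lower: "sublinear p \<Longrightarrow> - p (- x) \<le> p x"
  using sublinear_add[of p x "- x"] sublinear_zero[of p] by simp

text \<open>Fix \<open>x\<close>. As a function of \<open>y\<close>, the infimum of
  \<open>p (y + t *\<^sub>R x) - t * p x\<close> over \<open>t \<ge> 0\<close> is again sublinear
  and lies below \<open>p\<close>, so it equals \<open>p\<close> by minimality. Its term at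
  \<open>t = 1\<close> is the reverse of subadditivity.\<close>

lemma minimal_sublinear_linear:
  assumes p: "sublinear p" and min: "\<And>q. sublinear q \<Longrightarrow> (\<And>x. q x \<le> p x) \<Longrightarrow> q = p"
  shows "linear p"
proof -
  have add: "p (y + x) = p y + p x" for x y
  proof -
    define q where "q y = (INF t\<in>{0..}. p (y + t *\<^sub>R x) - t * p x)" for y
    have low: "- p (- y) \<le> p (y + t *\<^sub>R x) - t * p x" if "0 \<le> t" for t y
      using sublinear_add[OF p, of "y + t *\<^sub>R x" "- y"] sublinear_scale[OF p that, of x] by simp
    have bdd: "bdd_below ((\<lambda>t. p (y + t *\<^sub>R x) - t * p x) ` {0..})" for y
      using low by (intro bdd_belowI[of _ "- p (- y)"]) auto
    have qle: "q y \<le> p (y + t *\<^sub>R x) - t * p x" if "0 \<le> t" for t y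
      unfolding q_def using that by (intro cINF_lower bdd) auto
    have qge: "m \<le> q y" if "\<And>t. 0 \<le> t \<Longrightarrow> m \<le> p (y + t *\<^sub>R x) - t * p x" for m y
      unfolding q_def using that by (intro cINF_greatest) auto
    have "sublinear q"
    proof (rule sublinearI)
      fix u v
      have "q (u + v) - (p (u + t *\<^sub>R x) - t * p x) \<le> q v" if t: "0 \<le> t" for t
      proof (rule qge)
        fix s :: real assume s: "0 \<le> s"
        have "q (u + v) \<le> p (u + v + (t + s) *\<^sub>R x) - (t + s) * p x" using s t by (intro qle) simp
        also have "p (u + v + (t + s) *\<^sub>R x) \<le> p (u + t *\<^sub>R x) + p (v + s *\<^sub>R x)"
          using sublinear_add[OF p, of "u + t *\<^sub>R x" "v + s *\<^sub>R x"] by (simp add: algebra_simps)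
        finally show "q (u + v) - (p (u + t *\<^sub>R x) - t * p x) \<le> p (v + s *\<^sub>R x) - s * p x"
          by (simp add: algebra_simps)
      qed
      then have "q (u + v) - q v \<le> q u" by (intro qge) (simp add: algebra_simps)
      then show "q (u + v) \<le> q u + q v" by simp
    next
      fix c :: real and u assume c: "0 < c"
      have "q (c *\<^sub>R u) / c \<le> q u"
      proof (rule qge)
        fix t :: real assume t: "0 \<le> t"
        have "q (c *\<^sub>R u) \<le> p (c *\<^sub>R u + (c * t) *\<^sub>R x) - (c * t) * p x"
          using c t by (intro qle) simp
        also have "\<dots> = c * (p (u + t *\<^sub>R x) - t * p x)"
          using sublinear_scale[OF p, of c "u + t *\<^sub>R x"] c by (simp add: algebra_simps)
        finally show "q (c *\<^sub>R u) / c \<le> p (u + t *\<^sub>R x) - t * p x"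
          using c by (simp add: field_simps)
      qed
      then show "q (c *\<^sub>R u) \<le> c * q u" using c by (simp add: field_simps)
    next
      show "q 0 = 0"
        using qle[of 0 0] qge[of 0 0] sublinear_scale[OF p] sublinear_zero[OF p] by force
    qed
    moreover have "q y \<le> p y" for y using qle[of 0 y] by simp
    ultimately have "q = p" by (rule min)
    then have "p y \<le> p (y + x) - p x" using qle[of 1 y] by simp
    with sublinear_add[OF p, of y x] show ?thesis by simp
  qed
  have neg: "p (- x) = - p x" for x
    using add[of "- x" x] sublinear_zero[OF p] by simp
  have "p (c *\<^sub>R x) = c * p x" for c x
  proof (cases "0 \<le> c")
    case False
    then show ?thesis using sublinear_scale[OF p, of "- c" x] neg[of "c *\<^sub>R x"] by simp
  qed (simp add: sublinear_scale[OF p])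
  with add show ?thesis by (intro linearI) auto
qed

text \<open>Zorn's lemma is applied to sublinear functionals on the whole space below
  \<open>p\<close>, not to partial linear extensions: a minimal one is linear.\<close>

theorem hahn_banach_sublinear:
  fixes p :: "'a::real_vector \<Rightarrow> real"
  assumes p: "sublinear p"
  obtains f where "linear f" "\<And>x. f x \<le> p x"
proof -
  define Q where "Q = {q. sublinear q \<and> (\<forall>x. q x \<le> p x)}"
  have "\<exists>m\<in>Q. \<forall>q\<in>Q. q \<le> m \<longrightarrow> q = m"
  \<comment> \<open>The order is reversed, so the maximal element of Zorn's lemma is a pointwise
    minimal functional and chains are bounded by their pointwise infimum.\<close>
  proof (rule predicate_Zorn[where P = "\<lambda>f g. g \<le> f"])
    show "partial_order_on Q (relation_of (\<lambda>f g. g \<le> f) Q)"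
      by (rule partial_order_on_relation_ofI) auto
  next
    fix C assume C: "C \<in> Chains (relation_of (\<lambda>f g. g \<le> f) Q)"
    have CQ: "C \<subseteq> Q" using C by (auto simp: Chains_def relation_of_def)
    have tot: "f \<le> g \<or> g \<le> f" if "f \<in> C" "g \<in> C" for f g
      using C that by (auto simp: Chains_def relation_of_def)
    show "\<exists>u\<in>Q. \<forall>a\<in>C. u \<le> a"
    proof (cases "C = {}")
      case True
      with p show ?thesis by (auto simp: Q_def)
    next
      case False
      define u where "u x = (INF q\<in>C. q x)" for x
      have sub: "sublinear q" if "q \<in> C" for q using that CQ by (auto simp: Q_def)
      have "- p (- x) \<le> q x" if "q \<in> C" for q x
      proof -
        have "q (- x) \<le> p (- x)" using that CQ by (auto simp: Q_def)
        with sublinear_lower[OF sub[OF that], of x] show ?thesis by linarith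
      qed
      then have bdd: "bdd_below ((\<lambda>q. q x) ` C)" for x by (intro bdd_belowI[of _ "- p (- x)"]) auto
      have ule: "u x \<le> q x" if "q \<in> C" for q x
        unfolding u_def using that by (intro cINF_lower bdd) auto
      have uge: "m \<le> u x" if "\<And>q. q \<in> C \<Longrightarrow> m \<le> q x" for m x
        unfolding u_def using that False by (intro cINF_greatest) auto
      have "sublinear u"
      proof (rule sublinearI)
        fix x y
        \<comment> \<open>An infimum of subadditive functions need not be subadditive; in a chain,
          \<open>q\<close> and \<open>r\<close> can both be replaced by the smaller of the
          two.\<close>
        have le: "u (x + y) \<le> q x + r y" if qr: "q \<in> C" "r \<in> C" for q r
        proof -
          obtain s where s: "s \<in> C" "s \<le> q" "s \<le> r" using tot[OF qr] qr by (metis order_refl)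
          have "u (x + y) \<le> s x + s y"
            using ule[OF s(1), of "x + y"] sublinear_add[OF sub[OF s(1)], of x y] by linarith
          with le_funD[OF s(2), of x] le_funD[OF s(3), of y] show ?thesis by linarith
        qed
        have "u (x + y) - r y \<le> u x" if "r \<in> C" for r
          using le that by (intro uge) (simp add: algebra_simps)
        then have "u (x + y) - u x \<le> u y" by (intro uge) (simp add: algebra_simps)
        then show "u (x + y) \<le> u x + u y" by simp
      next
        fix c :: real and x assume c: "0 < c"
        have "u (c *\<^sub>R x) / c \<le> u x"
        proof (rule uge)
          fix q assume q: "q \<in> C"
          show "u (c *\<^sub>R x) / c \<le> q x"
            using ule[OF q, of "c *\<^sub>R x"] sublinear_scale[OF sub[OF q], of c x] c
            by (simp add: field_simps)
        qed
        then show "u (c *\<^sub>R x) \<le> c * u x" using c by (simp add: field_simps)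
      next
        have "(\<lambda>q. q 0) ` C = {0}" using False sublinear_zero[OF sub] by (force simp: image_iff)
        then show "u 0 = 0" by (simp add: u_def)
      qed
      moreover have "u x \<le> p x" for x
      proof -
        obtain q where q: "q \<in> C" using False by blast
        then have "q x \<le> p x" using CQ by (auto simp: Q_def)
        with ule[OF q, of x] show ?thesis by linarith
      qed
      ultimately show ?thesis using ule by (auto simp: Q_def le_fun_def)
    qed
  qed
  then obtain m where m: "m \<in> Q" and min: "\<And>q. q \<in> Q \<Longrightarrow> q \<le> m \<Longrightarrow> q = m" by blast
  have "linear m"
  proof (rule minimal_sublinear_linear)
    show "sublinear m" using m by (simp add: Q_def)
    show "q = m" if "sublinear q" "\<And>x. q x \<le> m x" for q
    proof (rule min)
      have "q x \<le> p x" for x using m that(2)[of x] order_trans by (auto simp: Q_def)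
      with that(1) show "q \<in> Q" by (simp add: Q_def)
      show "q \<le> m" using that(2) by (simp add: le_funI)
    qed
  qed
  with m show thesis by (intro that) (auto simp: Q_def)
qed

text \<open>A cone of constraints \<open>r \<le> f x\<close> is solvable as soon as no single one violates the norm
  bound: apply Hahn--Banach to the infimum of the resulting upper bounds for \<open>f\<close>.\<close>

theorem hahn_banach_cone:
  fixes A :: "('a::real_normed_vector \<times> real) set"
  assumes ne: "A \<noteq> {}"
    and add: "\<And>a b. a \<in> A \<Longrightarrow> b \<in> A \<Longrightarrow> a + b \<in> A"
    and scale: "\<And>c a. 0 \<le> c \<Longrightarrow> a \<in> A \<Longrightarrow> c *\<^sub>R a \<in> A"
    and le: "\<And>x r. (x, r) \<in> A \<Longrightarrow> r \<le> M * norm x"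
    and M: "0 \<le> M"
  obtains f :: "'a \<Rightarrow>\<^sub>L real" where "norm f \<le> M" "\<And>x r. (x, r) \<in> A \<Longrightarrow> r \<le> blinfun_apply f x"
proof -
  \<comment> \<open>A constraint \<open>(y, r)\<close> forces
    \<open>f x = f (x + y) - f y \<le> M * norm (x + y) - r\<close>; \<open>p\<close> collects these
    upper bounds.\<close>
  define p where "p x = (INF a\<in>A. M * norm (x + fst a) - snd a)" for x
  have low: "- M * norm x \<le> M * norm (x + fst a) - snd a" if "a \<in> A" for a x
  proof -
    have "snd a \<le> M * norm (fst a)" using le[of "fst a" "snd a"] that by simp
    also have "norm (fst a) \<le> norm (x + fst a) + norm x"
      using norm_triangle_ineq4[of "x + fst a" x] by simp
    finally show ?thesis using M by (simp add: mult_left_mono distrib_left)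
  qed
  have bdd: "bdd_below ((\<lambda>a. M * norm (x + fst a) - snd a) ` A)" for x
    using low by (intro bdd_belowI[of _ "- M * norm x"]) auto
  have ple: "p x \<le> M * norm (x + fst a) - snd a" if "a \<in> A" for x a
    unfolding p_def using that by (intro cINF_lower bdd) auto
  have pge: "m \<le> p x" if "\<And>a. a \<in> A \<Longrightarrow> m \<le> M * norm (x + fst a) - snd a" for m x
    unfolding p_def using that ne by (intro cINF_greatest) auto
  have zero: "(0, 0) \<in> A" using ne scale[of 0] by (auto simp: zero_prod_def)
  have "sublinear p"
  proof (rule sublinearI)
    fix x y
    have "p (x + y) - (M * norm (x + fst a) - snd a) \<le> p y" if a: "a \<in> A" for a
    proof (rule pge)
      fix b assume b: "b \<in> A"
      have "p (x + y) \<le> M * norm ((x + fst a) + (y + fst b)) - (snd a + snd b)"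
        using ple[OF add[OF a b], of "x + y"] by (simp add: algebra_simps)
      also have "\<dots> \<le> M * (norm (x + fst a) + norm (y + fst b)) - (snd a + snd b)"
        using M by (intro diff_right_mono mult_left_mono norm_triangle_ineq)
      finally show "p (x + y) - (M * norm (x + fst a) - snd a) \<le> M * norm (y + fst b) - snd b"
        by (simp add: algebra_simps)
    qed
    then have "p (x + y) - p y \<le> p x" by (intro pge) (simp add: algebra_simps)
    then show "p (x + y) \<le> p x + p y" by simp
  next
    fix c :: real and x assume c: "0 < c"
    have "p (c *\<^sub>R x) / c \<le> p x"
    proof (rule pge)
      fix a assume a: "a \<in> A"
      have "p (c *\<^sub>R x) \<le> M * norm (c *\<^sub>R (x + fst a)) - c * snd a"
        using ple[OF scale[OF _ a], of c "c *\<^sub>R x"] c by (simp add: algebra_simps)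
      also have "norm (c *\<^sub>R (x + fst a)) = c * norm (x + fst a)" using c by simp
      finally show "p (c *\<^sub>R x) / c \<le> M * norm (x + fst a) - snd a"
        using c by (simp add: field_simps)
    qed
    then show "p (c *\<^sub>R x) \<le> c * p x" using c by (simp add: field_simps)
  next
    show "p 0 = 0"
      using ple[OF zero, of 0] pge[of 0 0] le by force
  qed
  then obtain f where f: "linear f" and fp: "\<And>x. f x \<le> p x" by (rule hahn_banach_sublinear) blast
  have up: "f x \<le> M * norm x" for x using fp[of x] ple[OF zero, of x] by simp
  have abs: "\<bar>f x\<bar> \<le> M * norm x" for x
    using up[of x] up[of "- x"] linear_neg[OF f, of x] by simp
  have bl: "bounded_linear f"
    using f abs by (auto intro!: bounded_linear_intro[where K = M] simp: linear_add linear_scale mult.commute)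
  show thesis
  proof (rule that[of "Blinfun f"])
    show "norm (Blinfun f) \<le> M"
      using abs M by (intro norm_blinfun_bound) (auto simp: bounded_linear_Blinfun_apply[OF bl])
    \<comment> \<open>At \<open>- x\<close> the norm term belonging to the constraint
      \<open>(x, r)\<close> vanishes, leaving \<open>f (- x) \<le> - r\<close>.\<close>
    show "r \<le> blinfun_apply (Blinfun f) x" if "(x, r) \<in> A" for x r
      using fp[of "- x"] ple[OF that, of "- x"] linear_neg[OF f, of x]
      by (simp add: bounded_linear_Blinfun_apply[OF bl])
  qed
qed

text \<open>The graph of \<open>L\<close> over \<open>M\<close> is a constraint cone, and since
  \<open>M\<close> contains \<open>- x\<close> along with \<open>x\<close>, the resulting
  inequalities are equalities.\<close>

lemma hahn_banach_extension:
  fixes L :: "'a::real_normed_vector \<Rightarrow> real"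
  assumes M: "subspace M" and B: "0 \<le> B"
    and add: "\<And>x y. x \<in> M \<Longrightarrow> y \<in> M \<Longrightarrow> L (x + y) = L x + L y"
    and scale: "\<And>c x. x \<in> M \<Longrightarrow> L (c *\<^sub>R x) = c * L x"
    and le: "\<And>x. x \<in> M \<Longrightarrow> L x \<le> B * norm x"
  obtains f :: "'a \<Rightarrow>\<^sub>L real" where "norm f \<le> B" "\<And>x. x \<in> M \<Longrightarrow> blinfun_apply f x = L x"
proof -
  obtain f :: "'a \<Rightarrow>\<^sub>L real" where nf: "norm f \<le> B"
    and f: "\<And>x r. (x, r) \<in> (\<lambda>x. (x, L x)) ` M \<Longrightarrow> r \<le> blinfun_apply f x"
  proof (rule hahn_banach_cone[of "(\<lambda>x. (x, L x)) ` M" B])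
    show "(\<lambda>x. (x, L x)) ` M \<noteq> {}" using M by (auto simp: subspace_def)
  qed (use M B le in \<open>auto simp: add scale subspace_add subspace_scale image_iff\<close>)
  show thesis
  proof (rule that[OF nf])
    fix x assume x: "x \<in> M"
    then have "- x \<in> M" using M by (simp add: subspace_neg)
    then show "blinfun_apply f x = L x"
      using f[of x "L x"] f[of "- x" "L (- x)"] x scale[OF x, of "- 1"]
      by (auto simp: blinfun.minus_right)
  qed
qed

text \<open>The constraint cone is the ray spanned by \<open>(x, norm x)\<close>; the norm bound
  gives the reverse inequality.\<close>

lemma norming_functional:
  fixes x :: "'a::real_normed_vector"
  obtains f :: "'a \<Rightarrow>\<^sub>L real" where "norm f \<le> 1" "blinfun_apply f x = norm x"
proof -
  obtain f :: "'a \<Rightarrow>\<^sub>L real" where nf: "norm f \<le> 1"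
    and f: "\<And>y r. (y, r) \<in> (\<lambda>t. (t *\<^sub>R x, t * norm x)) ` {0..} \<Longrightarrow> r \<le> blinfun_apply f y"
  proof (rule hahn_banach_cone[of "(\<lambda>t. (t *\<^sub>R x, t * norm x)) ` {0..}" 1])
    fix a b assume "a \<in> (\<lambda>t. (t *\<^sub>R x, t * norm x)) ` {0..}" "b \<in> (\<lambda>t. (t *\<^sub>R x, t * norm x)) ` {0..}"
    then obtain s t where "a = (t *\<^sub>R x, t * norm x)" "b = (s *\<^sub>R x, s * norm x)" "0 \<le> t" "0 \<le> s"
      by auto
    then show "a + b \<in> (\<lambda>t. (t *\<^sub>R x, t * norm x)) ` {0..}"
      by (intro image_eqI[of _ _ "t + s"]) (auto simp: algebra_simps)
  qed auto
  have "norm x \<le> blinfun_apply f x" using f[of x "norm x"] by force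
  moreover have "\<bar>blinfun_apply f x\<bar> \<le> 1 * norm x"
    using norm_blinfun[of f x] mult_right_mono[OF nf norm_ge_zero[of x]] by simp
  ultimately show thesis using nf that[of f] by simp
qed

text \<open>A ball of radius \<open>d\<close> around \<open>a\<close> misses \<open>C\<close>, so
  requiring values at least \<open>d\<close> on all \<open>c - a\<close> is compatible with the norm
  bound \<open>1\<close>.\<close>

theorem separation_point_closed_convex:
  fixes C :: "'a::real_normed_vector set"
  assumes C: "closed C" "convex C" and a: "a \<notin> C"
  obtains f :: "'a \<Rightarrow>\<^sub>L real" and b where "blinfun_apply f a < b" "\<And>c. c \<in> C \<Longrightarrow> b \<le> blinfun_apply f c"
proof (cases "C = {}")
  case True
  with that[of 0 1] show thesis by simp
next
  case False
  obtain d where d: "0 < d" "ball a d \<subseteq> - C"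
    using C(1) a by (metis ComplI closed_def openE)
  have dist: "d \<le> norm (c - a)" if "c \<in> C" for c
    using that d(2) by (force simp: subset_eq dist_norm norm_minus_commute not_less)
  define A where "A = (\<lambda>(t, c). (t *\<^sub>R (c - a), t * d)) ` ({0..} \<times> C)"
  have AI: "(t *\<^sub>R (c - a), t * d) \<in> A" if "0 \<le> t" "c \<in> C" for t c
    using that by (auto simp: A_def)
  obtain f :: "'a \<Rightarrow>\<^sub>L real" where f: "\<And>y r. (y, r) \<in> A \<Longrightarrow> r \<le> blinfun_apply f y"
  proof (rule hahn_banach_cone[of A 1])
    show "A \<noteq> {}" using False by (auto simp: A_def)
    fix u v assume "u \<in> A" "v \<in> A"
    then obtain s t x y where uv: "u = (t *\<^sub>R (x - a), t * d)" "v = (s *\<^sub>R (y - a), s * d)"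
      and st: "0 \<le> t" "0 \<le> s" and xy: "x \<in> C" "y \<in> C"
      by (auto simp: A_def)
    show "u + v \<in> A"
    proof (cases "t + s = 0")
      case True
      with st have "t = 0" "s = 0" by auto
      with uv AI[of 0 x] xy show ?thesis by simp
    next
      case False
      \<comment> \<open>Dividing by \<open>t + s\<close> turns the sum of two cone elements into a
        multiple of a single point of the convex set.\<close>
      define z where "z = (t / (t + s)) *\<^sub>R x + (s / (t + s)) *\<^sub>R y"
      have "z \<in> C" unfolding z_def using st xy False C(2)
        by (intro convexD) (auto simp: add_divide_distrib[symmetric])
      moreover have "u + v = ((t + s) *\<^sub>R (z - a), (t + s) * d)"
      proof -
        have "(t + s) *\<^sub>R z = t *\<^sub>R x + s *\<^sub>R y"
          using False by (simp add: z_def scaleR_right_distrib)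
        then show ?thesis unfolding uv by (simp add: algebra_simps)
      qed
      ultimately show ?thesis using AI[of "t + s" z] st by simp
    qed
  next
    fix c :: real and u assume "0 \<le> c" "u \<in> A"
    then obtain t x where "u = (t *\<^sub>R (x - a), t * d)" "0 \<le> t" "x \<in> C" by (auto simp: A_def)
    then show "c *\<^sub>R u \<in> A" using AI[of "c * t" x] \<open>0 \<le> c\<close> by (simp add: mult.assoc)
  next
    fix x r assume "(x, r) \<in> A"
    then show "r \<le> 1 * norm x" using dist by (auto simp: A_def mult_left_mono)
  qed auto
  show thesis
  proof (rule that[of f "blinfun_apply f a + d"])
    fix c assume "c \<in> C"
    with AI[of 1 c] f show "blinfun_apply f a + d \<le> blinfun_apply f c"
      by (force simp: blinfun.diff_right)
  qed (use d in simp)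
qed

section \<open>Milman's theorem in locally convex spaces\<close>

lemma lc_hausdorff_add:
  assumes "lc_hausdorff_topology T" "continuous_map X T f" "continuous_map X T g"
  shows "continuous_map X T (\<lambda>x. f x + g x)"
proof -
  have "continuous_map X T ((\<lambda>(x, y). x + y) \<circ> (\<lambda>x. (f x, g x)))"
    using assms by (intro continuous_map_compose[of X "prod_topology T T"] continuous_map_pairedI)
      (auto simp: lc_hausdorff_topology_def)
  then show ?thesis by (simp add: comp_def)
qed

lemma lc_hausdorff_scale:
  assumes "lc_hausdorff_topology T" "continuous_map X euclideanreal c" "continuous_map X T f"
  shows "continuous_map X T (\<lambda>x. c x *\<^sub>R f x)"
proof -
  have "continuous_map X T ((\<lambda>(c, x). c *\<^sub>R x) \<circ> (\<lambda>x. (c x, f x)))"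
    using assms by (intro continuous_map_compose[of X "prod_topology euclideanreal T"] continuous_map_pairedI)
      (auto simp: lc_hausdorff_topology_def)
  then show ?thesis by (simp add: comp_def)
qed

lemma lc_hausdorff_diff:
  assumes "lc_hausdorff_topology T" "continuous_map X T f" "continuous_map X T g"
  shows "continuous_map X T (\<lambda>x. f x - g x)"
  using lc_hausdorff_add[OF assms(1,2) lc_hausdorff_scale[OF assms(1) _ assms(3), of "\<lambda>_. - 1"]]
  by simp

lemma lc_hausdorff_topspace: "lc_hausdorff_topology T \<Longrightarrow> topspace T = UNIV"
  by (simp add: lc_hausdorff_topology_def)

text \<open>Written as the image of a product, so that compactness of \<open>A\<close> and
  \<open>B\<close> passes to it through the continuous parametrisation.\<close>

definition convex_join :: "'a::real_vector set \<Rightarrow> 'a set \<Rightarrow> 'a set" where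
  "convex_join A B = (\<lambda>(t, u, v). (1 - t) *\<^sub>R u + t *\<^sub>R v) ` ({0..1} \<times> A \<times> B)"

lemma convex_combine:
  assumes "convex C" "x \<in> C" "y \<in> C" "0 \<le> a" "0 \<le> b"
  obtains z where "z \<in> C" "a *\<^sub>R x + b *\<^sub>R y = (a + b) *\<^sub>R z"
proof (cases "a + b = 0")
  case True
  with assms(4,5) have "a = 0" "b = 0" by auto
  with assms(2) that[of x] show thesis by simp
next
  case False
  show thesis
  proof (rule that)
    show "(a / (a + b)) *\<^sub>R x + (b / (a + b)) *\<^sub>R y \<in> C"
      using assms False by (intro convexD) (auto simp: add_divide_distrib[symmetric])
  qed (use False in \<open>simp add: scaleR_right_distrib\<close>)
qed

lemma convex_convex_join:
  assumes A: "convex A" and B: "convex B"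
  shows "convex (convex_join A B)"
proof (rule convexI)
  fix x y :: 'a and a b :: real
  assume xy: "x \<in> convex_join A B" "y \<in> convex_join A B" and ab: "0 \<le> a" "0 \<le> b" "a + b = 1"
  obtain s u v where x: "x = (1 - s) *\<^sub>R u + s *\<^sub>R v" "0 \<le> s" "s \<le> 1" "u \<in> A" "v \<in> B"
    using xy(1) by (auto simp: convex_join_def)
  obtain t w z where y: "y = (1 - t) *\<^sub>R w + t *\<^sub>R z" "0 \<le> t" "t \<le> 1" "w \<in> A" "z \<in> B"
    using xy(2) by (auto simp: convex_join_def)
  \<comment> \<open>The combination is regrouped into its \<open>A\<close>-part and its
    \<open>B\<close>-part; each is a multiple of one point of the respective convex set.\<close>
  obtain p where p: "p \<in> A" "(a * (1 - s)) *\<^sub>R u + (b * (1 - t)) *\<^sub>R w = (a * (1 - s) + b * (1 - t)) *\<^sub>R p"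
    using x y ab by (elim convex_combine[OF A \<open>u \<in> A\<close> \<open>w \<in> A\<close>, rotated 2]) auto
  obtain q where q: "q \<in> B" "(a * s) *\<^sub>R v + (b * t) *\<^sub>R z = (a * s + b * t) *\<^sub>R q"
    using x y ab by (elim convex_combine[OF B \<open>v \<in> B\<close> \<open>z \<in> B\<close>, rotated 2]) auto
  define r where "r = a * s + b * t"
  have r1: "a * (1 - s) + b * (1 - t) = 1 - r" using ab by (simp add: r_def algebra_simps)
  have "r \<ge> 0" "1 - r \<ge> 0"
    unfolding r1[symmetric] unfolding r_def using x y ab by auto
  moreover have "a *\<^sub>R x + b *\<^sub>R y = (1 - r) *\<^sub>R p + r *\<^sub>R q"
    using p(2) q(2) unfolding r1 r_def[symmetric] unfolding x(1) y(1)
    by (simp add: scaleR_right_distrib algebra_simps)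
  ultimately show "a *\<^sub>R x + b *\<^sub>R y \<in> convex_join A B"
    using p(1) q(1) unfolding convex_join_def by (intro image_eqI[of _ _ "(r, p, q)"]) auto
qed

lemma convex_hull_Un_subset_join:
  assumes "A \<noteq> {}" "B \<noteq> {}"
  shows "convex hull (A \<union> B) \<subseteq> convex_join (convex hull A) (convex hull B)"
proof (rule hull_minimal)
  obtain a b where ab: "a \<in> A" "b \<in> B" using assms by auto
  have "x \<in> convex_join (convex hull A) (convex hull B)" if "x \<in> A" for x
    unfolding convex_join_def using that ab
    by (intro image_eqI[of _ _ "(0, x, b)"]) (auto intro: hull_inc)
  moreover have "x \<in> convex_join (convex hull A) (convex hull B)" if "x \<in> B" for x
    unfolding convex_join_def using that ab
    by (intro image_eqI[of _ _ "(1, a, x)"]) (auto intro: hull_inc)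
  ultimately show "A \<union> B \<subseteq> convex_join (convex hull A) (convex hull B)" by auto
qed (simp add: convex_convex_join)

lemma compactin_convex_join:
  assumes T: "lc_hausdorff_topology T" and A: "compactin T A" and B: "compactin T B"
  shows "compactin T (convex_join A B)"
proof -
  have fst: "continuous_map (prod_topology euclideanreal (prod_topology T T)) euclideanreal fst"
    and u: "continuous_map (prod_topology euclideanreal (prod_topology T T)) T (fst \<circ> snd)"
    and v: "continuous_map (prod_topology euclideanreal (prod_topology T T)) T (snd \<circ> snd)"
    by (auto intro: continuous_map_fst continuous_map_snd continuous_map_compose)
  have "continuous_map (prod_topology euclideanreal (prod_topology T T)) T
      (\<lambda>p. (1 - fst p) *\<^sub>R (fst \<circ> snd) p + fst p *\<^sub>R (snd \<circ> snd) p)"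
    using fst u v unfolding comp_def by (intro lc_hausdorff_add lc_hausdorff_scale T continuous_map_diff) (auto simp: comp_def)
  moreover have "compactin (prod_topology euclideanreal (prod_topology T T)) ({0..1} \<times> A \<times> B)"
    using A B by (simp add: compactin_Times)
  ultimately have "compactin T
      ((\<lambda>p. (1 - fst p) *\<^sub>R (fst \<circ> snd) p + fst p *\<^sub>R (snd \<circ> snd) p) ` ({0..1} \<times> A \<times> B))"
    by (rule image_compactin[rotated])
  then show ?thesis by (simp add: convex_join_def case_prod_beta comp_def)
qed

text \<open>Induction on the cover. The closed hull of \<open>L\<close> lies in the join of the
  closed hulls of \<open>L \<inter> W\<close> and \<open>L - W\<close>. An extreme point of
  \<open>C\<close> on a joining segment must be an endpoint, so it belongs to the piece of
  \<open>W\<close> or to the closed hull of \<open>L - W\<close>, which the remaining sets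
  cover.\<close>

lemma extreme_point_in_piece:
  assumes T: "lc_hausdorff_topology T" and C: "compactin T C"
    and fin: "finite \<W>" and L: "L \<subseteq> \<Union>\<W>" "T closure_of (convex hull L) \<subseteq> C"
    and a: "a \<in> T closure_of (convex hull L)" "a extreme_point_of C"
  shows "\<exists>W\<in>\<W>. a \<in> T closure_of (convex hull (L \<inter> W))"
  using fin L a(1)
proof (induction \<W> arbitrary: L)
  case empty
  then show ?case by simp
next
  case (insert W \<W>)
  define hc where "hc S = T closure_of (convex hull S)" for S
  have mono: "hc S \<subseteq> hc S'" if "S \<subseteq> S'" for S S'
    unfolding hc_def using that by (intro closure_of_mono hull_mono)
  have haus: "Hausdorff_space T" using T by (simp add: lc_hausdorff_topology_def)
  have IH: "\<exists>W'\<in>\<W>. a \<in> hc (L \<inter> W')" if "a \<in> hc (L - W)"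
  proof -
    have "\<exists>W'\<in>\<W>. a \<in> hc ((L - W) \<inter> W')"
      unfolding hc_def
    proof (rule insert.IH)
      show "T closure_of (convex hull (L - W)) \<subseteq> C"
        using mono[of "L - W" L] insert.prems(2) by (auto simp: hc_def)
    qed (use insert.prems that in \<open>auto simp: hc_def\<close>)
    then show ?thesis using mono[of "(L - W) \<inter> _" "L \<inter> _"] by blast
  qed
  \<comment> \<open>A join with an empty set is empty, so an empty piece is treated
    separately.\<close>
  show ?case
  proof (cases "L \<inter> W = {} \<or> L - W = {}")
    case True
    then have "L - W = L \<or> L \<inter> W = L" by blast
    then show ?thesis using IH insert.prems(3) by (auto simp: hc_def)
  next
    case False
    have comp: "compactin T (hc S)" if "S \<subseteq> L" for S
      using mono[OF that] insert.prems(2)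
      by (intro closed_compactin[OF C]) (auto simp: hc_def)
    have incl: "convex hull S \<subseteq> hc S" for S
      unfolding hc_def by (rule closure_of_subset) (simp add: lc_hausdorff_topspace[OF T])
    \<comment> \<open>The join of two compact sets is compact, hence closed in a Hausdorff space,
      and therefore absorbs the closure of the hull.\<close>
    have "hc L \<subseteq> convex_join (hc (L \<inter> W)) (hc (L - W))"
      unfolding hc_def[of L]
    proof (rule closure_of_minimal)
      have "convex hull L = convex hull ((L \<inter> W) \<union> (L - W))" by (simp add: Int_Diff_Un)
      also have "\<dots> \<subseteq> convex_join (convex hull (L \<inter> W)) (convex hull (L - W))"
        using False by (intro convex_hull_Un_subset_join) auto
      also have "\<dots> \<subseteq> convex_join (hc (L \<inter> W)) (hc (L - W))"
        unfolding convex_join_def using incl by (intro image_mono Sigma_mono) auto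
      finally show "convex hull L \<subseteq> convex_join (hc (L \<inter> W)) (hc (L - W))" .
      show "closedin T (convex_join (hc (L \<inter> W)) (hc (L - W)))"
        by (intro compactin_imp_closedin haus compactin_convex_join T comp) auto
    qed
    with insert.prems(3) obtain t u v where a_eq: "a = (1 - t) *\<^sub>R u + t *\<^sub>R v"
      and t: "0 \<le> t" "t \<le> 1" and uv: "u \<in> hc (L \<inter> W)" "v \<in> hc (L - W)"
      by (auto simp: hc_def convex_join_def)
    have "u \<in> C" "v \<in> C"
      using uv mono[of "L \<inter> W" L] mono[of "L - W" L] insert.prems(2) by (auto simp: hc_def)
    with a(2) have "a \<notin> open_segment u v" by (simp add: extreme_point_of_def)
    moreover have "a \<in> closed_segment u v" using t a_eq by (auto simp: in_segment)
    ultimately have "a = u \<or> a = v" by (simp add: open_segment_def)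
    with uv IH show ?thesis by (auto simp: hc_def)
  qed
qed

text \<open>Convex neighbourhoods are given only at the origin, so a neighbourhood of
  \<open>x\<close> disjoint from one of \<open>a\<close> is translated there, shrunk, and translated
  back.\<close>

lemma lc_hausdorff_convex_neighbourhood:
  assumes T: "lc_hausdorff_topology T" and "x \<noteq> a"
  obtains W where "openin T W" "convex W" "x \<in> W" "a \<notin> T closure_of W"
proof -
  note tsp = lc_hausdorff_topspace[OF T]
  have "Hausdorff_space T" using T by (simp add: lc_hausdorff_topology_def)
  then obtain U U' where U: "openin T U" "openin T U'" "x \<in> U" "a \<in> U'" "disjnt U U'"
    using \<open>x \<noteq> a\<close> unfolding Hausdorff_space_def tsp by (metis UNIV_I)
  have trans: "openin T ((\<lambda>v. v + b) -` S)" if "openin T S" for S b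
    using openin_continuous_map_preimage[of T T "\<lambda>v. v + b", OF _ that] lc_hausdorff_add[OF T, of T id "\<lambda>_. b"]
    by (simp add: tsp vimage_def)
  from trans[OF U(1), of x] obtain V where V: "openin T V" "convex V" "0 \<in> V" "V \<subseteq> (\<lambda>v. v + x) -` U"
    using T U(3) unfolding lc_hausdorff_topology_def by (metis add_0 vimage_eq)
  let ?W = "(\<lambda>v. v + (- x)) -` V"
  have W: "?W = (\<lambda>v. v + x) ` V" by (force simp: image_iff)
  show thesis
  proof (rule that)
    show "openin T ?W" by (rule trans[OF V(1)])
    show "convex ?W" unfolding W using convex_translation[OF V(2), of x] by (simp add: add.commute)
    show "x \<in> ?W" using V(3) by simp
    have "?W \<subseteq> U" using V(4) by (auto simp: W)
    with U(5) have "disjnt U' ?W" by (auto simp: disjnt_def)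
    then show "a \<notin> T closure_of ?W"
      using U by (auto simp: in_closure_of disjnt_def)
  qed
qed

text \<open>If \<open>a \<notin> K\<close>, finitely many convex open sets whose closures miss
  \<open>a\<close> cover \<open>K\<close>. The extreme point would lie in the closed hull of some
  \<open>K \<inter> W\<close>, hence in the closure of \<open>W\<close>.\<close>

theorem milman:
  assumes T: "lc_hausdorff_topology T" and K: "compactin T K"
    and C: "compactin T (T closure_of (convex hull K))"
    and a: "a extreme_point_of (T closure_of (convex hull K))"
  shows "a \<in> K"
proof (rule ccontr)
  assume "a \<notin> K"
  define \<U> where "\<U> = {W. openin T W \<and> convex W \<and> a \<notin> T closure_of W}"
  have "\<exists>W\<in>\<U>. x \<in> W" if "x \<in> K" for x
    using lc_hausdorff_convex_neighbourhood[OF T, of x a] that \<open>a \<notin> K\<close> unfolding \<U>_def by blast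
  then have "K \<subseteq> \<Union>\<U>" by blast
  with compactinD[OF K, of \<U>] obtain \<W> where \<W>: "finite \<W>" "\<W> \<subseteq> \<U>" "K \<subseteq> \<Union>\<W>"
    by (auto simp: \<U>_def)
  have "a \<in> T closure_of (convex hull K)" using a by (simp add: extreme_point_of_def)
  with extreme_point_in_piece[OF T C \<W>(1,3) order_refl _ a]
  obtain W where W: "W \<in> \<W>" "a \<in> T closure_of (convex hull (K \<inter> W))" by blast
  have "convex hull (K \<inter> W) \<subseteq> W" using W(1) \<W>(2) by (intro hull_minimal) (auto simp: \<U>_def)
  then show False using W closure_of_mono \<W>(2) by (fastforce simp: \<U>_def)
qed

section \<open>The weak topology\<close>

lemma openin_weak_vimage:
  fixes f :: "'a::real_normed_vector \<Rightarrow> real"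
  assumes "bounded_linear f" "open U"
  shows "openin weak_top (f -` U)"
  unfolding weak_top_def using assms
  by (intro topology_generated_by_Basis CollectI exI[of _ f] exI[of _ U]) simp

lemma topspace_weak_top [simp]: "topspace (weak_top :: 'a::real_normed_vector topology) = UNIV"
  using openin_weak_vimage[OF bounded_linear_zero[where 'a='a], of UNIV] openin_subset by fastforce

lemma bounded_linear_continuous_map_weak:
  fixes f :: "'a::real_normed_vector \<Rightarrow> real"
  assumes "bounded_linear f"
  shows "continuous_map weak_top euclideanreal f"
  using openin_weak_vimage[OF assms] by (auto simp: continuous_map_def vimage_def)

text \<open>Universal property of the initial topology: it reduces continuity of the vector
  operations, and later of \<open>inv \<Phi>\<close>, to scalar functions.\<close>

lemma continuous_map_into_weak:
  fixes g :: "'b \<Rightarrow> 'a::real_normed_vector"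
  assumes "\<And>f :: 'a \<Rightarrow> real. bounded_linear f \<Longrightarrow> continuous_map X euclideanreal (\<lambda>x. f (g x))"
  shows "continuous_map X weak_top g"
  unfolding weak_top_def
proof (rule continuous_on_generated_topo)
  fix U assume "U \<in> {f -` U | f U. bounded_linear (f :: 'a \<Rightarrow> real) \<and> open U}"
  then obtain f :: "'a \<Rightarrow> real" and V where U: "U = f -` V" "bounded_linear f" "open V" by blast
  have "openin X {x \<in> topspace X. f (g x) \<in> V}"
    using assms[OF U(2)] U(3) by (intro openin_continuous_map_preimage) auto
  moreover have "{x \<in> topspace X. f (g x) \<in> V} = g -` U \<inter> topspace X"
    by (auto simp: U)
  ultimately show "openin X (g -` U \<inter> topspace X)" by simp
next
  have "\<Union>{f -` U | f U. bounded_linear (f :: 'a \<Rightarrow> real) \<and> open U} = UNIV"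
    using topspace_weak_top[where 'a='a] unfolding weak_top_def topology_generated_by_topspace .
  then show "g ` topspace X \<subseteq> \<Union>{f -` U | f U. bounded_linear (f :: 'a \<Rightarrow> real) \<and> open U}" by simp
qed

text \<open>Induction on how the open set is generated: subbasic sets contain preimages of
  intervals, which are convex, and intersections keep convexity.\<close>

lemma openin_weak_convex_neighbourhood:
  fixes U :: "'a::real_normed_vector set"
  assumes "openin weak_top U" "x \<in> U"
  shows "\<exists>V. openin weak_top V \<and> convex V \<and> x \<in> V \<and> V \<subseteq> U"
proof -
  have "generate_topology_on {f -` U | f U. bounded_linear (f :: 'a \<Rightarrow> real) \<and> open U} U"
    using assms(1) unfolding weak_top_def by (rule openin_topology_generated_by)
  then show ?thesis using assms(2)
  proof (induction arbitrary: x)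
    case (Int A B)
    from Int.IH(1)[of x] Int.IH(2)[of x] Int.prems obtain V V' where
      "openin weak_top V" "convex V" "x \<in> V" "V \<subseteq> A" "openin weak_top V'" "convex V'" "x \<in> V'" "V' \<subseteq> B"
      by blast
    then show ?case by (intro exI[of _ "V \<inter> V'"]) (auto intro: convex_Int)
  next
    case (UN \<K>)
    then show ?case by (meson UnionE Union_upper order_trans)
  next
    case (Basis S)
    then obtain f :: "'a \<Rightarrow> real" and U where S: "S = f -` U" "bounded_linear f" "open U" by blast
    with Basis.prems obtain e where e: "0 < e" "ball (f x) e \<subseteq> U" by (metis openE vimage_eq)
    have "openin weak_top (f -` ball (f x) e)"
      using S(2) by (rule openin_weak_vimage) simp
    moreover have "convex (f -` ball (f x) e)"
      using S(2) by (intro convex_linear_vimage) (auto simp: bounded_linear.linear)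
    ultimately show ?case using e S by (intro exI[of _ "f -` ball (f x) e"]) auto
  qed simp
qed

lemma Hausdorff_weak_top: "Hausdorff_space (weak_top :: 'a::real_normed_vector topology)"
  unfolding Hausdorff_space_def
proof (intro allI impI)
  fix x y :: 'a assume "x \<in> topspace weak_top \<and> y \<in> topspace weak_top \<and> x \<noteq> y"
  then have "x \<noteq> y" by simp
  obtain f :: "'a \<Rightarrow>\<^sub>L real" where "blinfun_apply f (x - y) = norm (x - y)" by (rule norming_functional)
  with \<open>x \<noteq> y\<close> have "blinfun_apply f x \<noteq> blinfun_apply f y" by (auto simp: blinfun.diff_right)
  then obtain U V where UV: "open U" "open V" "blinfun_apply f x \<in> U" "blinfun_apply f y \<in> V" "U \<inter> V = {}"
    using hausdorff by metis
  have "openin weak_top (blinfun_apply f -` W)" if "open W" for W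
    using that by (intro openin_weak_vimage blinfun.bounded_linear_right)
  with UV show "\<exists>U V. openin weak_top U \<and> openin weak_top V \<and> x \<in> U \<and> y \<in> V \<and> disjnt U V"
    by (intro exI[of _ "blinfun_apply f -` U"] exI[of _ "blinfun_apply f -` V"]) (auto simp: disjnt_def)
qed

lemma lc_hausdorff_weak_top: "lc_hausdorff_topology (weak_top :: 'a::real_normed_vector topology)"
  unfolding lc_hausdorff_topology_def
proof (intro conjI allI impI)
  have w: "continuous_map weak_top euclideanreal f" if "bounded_linear f" for f :: "'a \<Rightarrow> real"
    using that by (rule bounded_linear_continuous_map_weak)
  show "continuous_map (prod_topology weak_top weak_top) weak_top (\<lambda>(x, y). x + y :: 'a)"
  proof (rule continuous_map_into_weak)
    fix f :: "'a \<Rightarrow> real" assume f: "bounded_linear f"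
    have "continuous_map (prod_topology weak_top weak_top) euclideanreal (\<lambda>z. (f \<circ> fst) z + (f \<circ> snd) z)"
      using w[OF f] by (intro continuous_map_add continuous_map_compose[of _ weak_top]
          continuous_map_fst continuous_map_snd)
    then show "continuous_map (prod_topology weak_top weak_top) euclideanreal (\<lambda>z. f (case z of (x, y) \<Rightarrow> x + y))"
      by (simp add: case_prod_beta comp_def linear_add bounded_linear.linear[OF f])
  qed
  show "continuous_map (prod_topology euclideanreal weak_top) weak_top (\<lambda>(c, x). c *\<^sub>R x :: 'a)"
  proof (rule continuous_map_into_weak)
    fix f :: "'a \<Rightarrow> real" assume f: "bounded_linear f"
    have "continuous_map (prod_topology euclideanreal weak_top) euclideanreal (\<lambda>z. fst z * (f \<circ> snd) z)"
      using w[OF f] by (intro continuous_map_real_mult continuous_map_compose[of _ weak_top]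
          continuous_map_fst continuous_map_snd)
    then show "continuous_map (prod_topology euclideanreal weak_top) euclideanreal (\<lambda>z. f (case z of (c, x) \<Rightarrow> c *\<^sub>R x))"
      by (simp add: case_prod_beta comp_def linear_scale bounded_linear.linear[OF f])
  qed
  fix U :: "'a set" assume "openin weak_top U \<and> 0 \<in> U"
  then show "\<exists>V. openin weak_top V \<and> convex V \<and> 0 \<in> V \<and> V \<subseteq> U"
    by (intro openin_weak_convex_neighbourhood) auto
qed (simp_all add: Hausdorff_weak_top)

text \<open>Mazur's theorem: separation puts each outside point into a weakly open half-space
  missing \<open>C\<close>.\<close>

theorem closedin_weak_convex:
  fixes C :: "'a::real_normed_vector set"
  assumes "closed C" "convex C"
  shows "closedin weak_top C"
proof -
  have "openin weak_top (- C)"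
  proof (subst openin_subopen, intro ballI)
    fix a assume "a \<in> - C"
    with assms obtain f :: "'a \<Rightarrow>\<^sub>L real" and b
      where f: "blinfun_apply f a < b" "\<And>c. c \<in> C \<Longrightarrow> b \<le> blinfun_apply f c"
      by (elim separation_point_closed_convex) auto
    have "openin weak_top (blinfun_apply f -` {..<b})"
      by (intro openin_weak_vimage blinfun.bounded_linear_right) simp
    then show "\<exists>V. openin weak_top V \<and> a \<in> V \<and> V \<subseteq> - C"
      using f by (intro exI[of _ "blinfun_apply f -` {..<b}"]) (force simp: not_less)
  qed
  then show ?thesis by (simp add: closedin_def Compl_eq_Diff_UNIV)
qed

lemma continuous_map_id_weak: "continuous_map euclidean weak_top (\<lambda>x :: 'a::real_normed_vector. x)"
  by (rule continuous_map_into_weak) (simp add: linear_continuous_on)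

text \<open>One inclusion is Mazur's theorem, the other the continuity of the identity from the norm
  to the weak topology.\<close>

lemma weak_closure_of_convex:
  fixes C :: "'a::real_normed_vector set"
  assumes "convex C"
  shows "weak_top closure_of C = closure C"
proof
  show "weak_top closure_of C \<subseteq> closure C"
    using assms by (intro closure_of_minimal closure_subset closedin_weak_convex) (auto simp: convex_closure)
  have "closed (weak_top closure_of C)"
    using closedin_continuous_map_preimage[OF continuous_map_id_weak closedin_closure_of[of weak_top C]]
    by simp
  then show "closure C \<subseteq> weak_top closure_of C"
    by (intro closure_minimal closure_of_subset) auto
qed

section \<open>Solid convex hulls in a Banach lattice\<close>

lemma labs_le_iff: "labs x \<le> z \<longleftrightarrow> x \<le> z \<and> - x \<le> z" for x :: "'a::{lattice,uminus}"
  by (simp add: labs_def)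

lemma labs_ge: "x \<le> labs x" "- x \<le> labs x" for x :: "'a::{lattice,uminus}"
  by (simp_all add: labs_def)

lemma labs_nonneg: "0 \<le> labs x" for x :: "'a::banach_lattice"
proof -
  have "x + - x \<le> labs x + labs x" by (intro add_mono labs_ge)
  then have "0 \<le> (1/2) *\<^sub>R (labs x + labs x)" by (intro scaleR_nonneg_nonneg) auto
  then show ?thesis by (simp add: scaleR_right_distrib scaleR_left_distrib[symmetric])
qed

lemma labs_of_nonneg: "0 \<le> x \<Longrightarrow> labs x = x" for x :: "'a::banach_lattice"
  unfolding labs_def by (rule sup_absorb1) (meson neg_le_0_iff_le order_trans)

lemma convex_sch: "convex (sch S)"
  unfolding sch_def by (rule convex_Inter) auto

lemma subset_sch: "S \<subseteq> sch S"
  unfolding sch_def by blast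

lemma sch_minimal: "convex C \<Longrightarrow> solid C \<Longrightarrow> S \<subseteq> C \<Longrightarrow> sch S \<subseteq> C"
  unfolding sch_def by blast

text \<open>The set on the right is convex and solid, and it contains \<open>K\<close> because
  positive elements equal their modulus.\<close>

lemma sch_positive_dominated:
  fixes K :: "'a::banach_lattice set"
  assumes "K \<subseteq> {x. 0 \<le> x}"
  shows "sch K \<subseteq> {x. \<exists>z\<in>convex hull K. labs x \<le> z}"
proof (rule sch_minimal)
  show "convex {x. \<exists>z\<in>convex hull K. labs x \<le> z}"
  proof (rule convexI)
    fix x y :: 'a and a b :: real
    assume "x \<in> {x. \<exists>z\<in>convex hull K. labs x \<le> z}" "y \<in> {x. \<exists>z\<in>convex hull K. labs x \<le> z}"
      and ab: "0 \<le> a" "0 \<le> b" "a + b = 1"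
    then obtain z w where zw: "z \<in> convex hull K" "x \<le> z" "- x \<le> z" "w \<in> convex hull K" "y \<le> w" "- y \<le> w"
      by (auto simp: labs_le_iff)
    have "a *\<^sub>R z + b *\<^sub>R w \<in> convex hull K" using zw ab by (intro convexD convex_convex_hull)
    moreover have "a *\<^sub>R x + b *\<^sub>R y \<le> a *\<^sub>R z + b *\<^sub>R w"
      using zw ab by (intro add_mono scaleR_left_mono)
    moreover have "a *\<^sub>R (- x) + b *\<^sub>R (- y) \<le> a *\<^sub>R z + b *\<^sub>R w"
      using zw ab by (intro add_mono scaleR_left_mono)
    ultimately show "a *\<^sub>R x + b *\<^sub>R y \<in> {x. \<exists>z\<in>convex hull K. labs x \<le> z}"
      by (auto simp: labs_le_iff)
  qed
  show "solid {x. \<exists>z\<in>convex hull K. labs x \<le> z}"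
    unfolding solid_def by (blast intro: order_trans)
  show "K \<subseteq> {x. \<exists>z\<in>convex hull K. labs x \<le> z}"
    using assms by (force simp: labs_of_nonneg intro: hull_inc)
qed

text \<open>The set is the projection of the closed relation \<open>0 \<le> z - x\<close> along the
  compact factor \<open>C\<close>, and such a projection is a closed map.\<close>

lemma closedin_downward_closure:
  fixes T :: "'a::banach_lattice topology"
  assumes T: "lc_hausdorff_topology T" and pos: "closedin T {x. 0 \<le> x}" and C: "compactin T C"
  shows "closedin T {x. \<exists>z\<in>C. x \<le> z}"
proof -
  let ?P = "prod_topology T (subtopology T C)"
  have "continuous_map ?P T (\<lambda>p. snd p - fst p)"
    by (intro lc_hausdorff_diff T continuous_map_fst continuous_map_into_fulltopology[OF continuous_map_snd])
  then have "closedin ?P {p \<in> topspace ?P. snd p - fst p \<in> {x. 0 \<le> x}}"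
    using pos by (rule closedin_continuous_map_preimage)
  moreover have "closed_map ?P T fst"
    using C by (intro closed_map_fst) (simp add: compactin_subspace)
  ultimately have "closedin T (fst ` {p \<in> topspace ?P. snd p - fst p \<in> {x. 0 \<le> x}})"
    by (simp add: closed_map_def)
  moreover have "fst ` {p \<in> topspace ?P. snd p - fst p \<in> {x. 0 \<le> x}} = {x. \<exists>z\<in>C. x \<le> z}"
    using lc_hausdorff_topspace[OF T] by (force simp: image_iff)
  ultimately show ?thesis by simp
qed

theorem oep_closure_sch_subset:
  fixes T :: "'a::banach_lattice topology"
  assumes T: "lc_hausdorff_topology T" and pos: "closedin T {x. 0 \<le> x}"
    and K: "K \<subseteq> {x. 0 \<le> x}" "compactin T K" and C: "compactin T (T closure_of (convex hull K))"
  shows "oep (T closure_of (sch K)) \<subseteq> K"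
proof
  fix a assume a: "a \<in> oep (T closure_of (sch K))"
  let ?C = "T closure_of (convex hull K)"
  have aS: "a \<in> T closure_of (sch K)"
    and dom: "\<And>x y t. \<lbrakk>x \<in> T closure_of (sch K); y \<in> T closure_of (sch K); 0 < t; t < 1;
        a \<le> (1 - t) *\<^sub>R x + t *\<^sub>R y\<rbrakk> \<Longrightarrow> x = a \<and> y = a"
    using a by (auto simp: oep_def)
  have CS: "?C \<subseteq> T closure_of (sch K)"
    by (intro closure_of_mono hull_minimal convex_sch subset_sch)
  have hC: "convex hull K \<subseteq> ?C"
    by (intro closure_of_subset) (simp add: lc_hausdorff_topspace[OF T])
  have "T closure_of (sch K) \<subseteq> {x. \<exists>z\<in>?C. x \<le> z}"
  proof (intro closure_of_minimal closedin_downward_closure T pos C)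
    show "sch K \<subseteq> {x. \<exists>z\<in>?C. x \<le> z}"
      using sch_positive_dominated[OF K(1)] hC by (fastforce simp: labs_le_iff)
  qed
  with aS obtain z where z: "z \<in> ?C" "a \<le> z" by blast
  \<comment> \<open>Order extremality with both endpoints equal to \<open>z\<close> forces
    \<open>z = a\<close>.\<close>
  then have "a \<le> (1 - 1/2) *\<^sub>R z + (1/2) *\<^sub>R z" by (simp add: scaleR_left_distrib[symmetric])
  with dom[of z z "1/2"] z CS have "z = a" by auto
  with z have "a \<in> ?C" by simp
  \<comment> \<open>Order extremality would identify both \<open>x\<close> and \<open>y\<close> with
    \<open>a\<close>, but the endpoints of a nonempty open segment are distinct.\<close>
  moreover have False if "x \<in> ?C" "y \<in> ?C" "a \<in> open_segment x y" for x y
    using that dom[of x y] CS by (fastforce simp: in_segment)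
  ultimately have "a extreme_point_of ?C" by (auto simp: extreme_point_of_def)
  with T K(2) C show "a \<in> K" by (rule milman)
qed

section \<open>Norm continuity of the modulus\<close>

lemma norm_le_of_labs_le: "labs x \<le> labs y \<Longrightarrow> norm x \<le> norm y" for x :: "'a::banach_lattice"
  unfolding labs_def by (rule lattice_norm)

text \<open>The reverse triangle inequality for the modulus holds in the order, and the lattice norm
  is monotone in the modulus.\<close>

lemma norm_labs_diff_le: "norm (labs x - labs y) \<le> norm (x - y)" for x :: "'a::banach_lattice"
proof (rule norm_le_of_labs_le)
  have le: "labs u \<le> labs (u - v) + labs v" for u v :: 'a
  proof -
    have "u \<le> labs (u - v) + labs v" "- u \<le> labs (u - v) + labs v"
      using add_mono[OF labs_ge(1)[of "u - v"] labs_ge(1)[of v]]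
        add_mono[OF labs_ge(2)[of "u - v"] labs_ge(2)[of v]] by simp_all
    then show ?thesis by (simp add: labs_le_iff)
  qed
  have "labs (y - x) = labs (x - y)" by (simp add: labs_def sup_commute)
  with le[of x y] le[of y x] show "labs (labs x - labs y) \<le> labs (x - y)"
    by (simp add: labs_le_iff[of "labs x - labs y"] algebra_simps)
qed

lemma continuous_on_labs: "continuous_on A (labs :: 'a::banach_lattice \<Rightarrow> 'a)"
  unfolding continuous_on_iff dist_norm by (meson norm_labs_diff_le order_le_less_trans)

text \<open>The cone is the fixed-point set of the continuous map \<open>labs\<close>.\<close>

lemma closed_positive_cone: "closed {x :: 'a::banach_lattice. 0 \<le> x}"
proof -
  have "{x :: 'a. 0 \<le> x} = {x. labs x = x}"
    using labs_nonneg labs_of_nonneg by (metis (mono_tags, lifting))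
  then show ?thesis by (auto intro!: closed_Collect_eq continuous_on_labs)
qed

lemma convex_positive_cone: "convex {x :: 'a::banach_lattice. 0 \<le> x}"
  by (auto simp: convex_def intro!: add_nonneg_nonneg scaleR_nonneg_nonneg)

text \<open>Since \<open>x\<close> and \<open>labs x\<close> have the same modulus, a solid set
  contains both or neither.\<close>

lemma sch_labs_image: "sch (labs ` K) = sch K" for K :: "'a::banach_lattice set"
proof -
  have "K \<subseteq> C \<longleftrightarrow> labs ` K \<subseteq> C" if "solid C" for C :: "'a set"
    using that labs_of_nonneg[OF labs_nonneg] unfolding solid_def image_subset_iff
    by (metis order_refl subset_iff)
  then have "{C. convex C \<and> solid C \<and> labs ` K \<subseteq> C} = {C. convex C \<and> solid C \<and> K \<subseteq> C}" by blast
  then show ?thesis by (simp add: sch_def)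
qed

section \<open>Simons' lemma\<close>

text \<open>Placing the remaining weight \<open>(1/2) ^ m\<close> on a point of \<open>C\<close>
  completes a partial sum to a convex combination; this correction tends to zero and
  \<open>C\<close> is closed.\<close>

lemma halving_series_mem:
  fixes C :: "'b::banach set"
  assumes C: "closed C" "convex C" and bnd: "\<And>x. x \<in> C \<Longrightarrow> norm x \<le> B" and h: "\<And>k. h k \<in> C"
  shows "summable (\<lambda>k. (1/2) ^ Suc k *\<^sub>R h k)" "(\<Sum>k. (1/2) ^ Suc k *\<^sub>R h k) \<in> C"
proof -
  have "summable (\<lambda>k. B * (1/2) ^ Suc k)"
    by (intro summable_mult) (simp add: summable_geometric)
  then show sm: "summable (\<lambda>k. (1/2) ^ Suc k *\<^sub>R h k)"
  proof (rule summable_comparison_test'[where N = 0])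
    show "norm ((1/2) ^ Suc k *\<^sub>R h k) \<le> B * (1/2) ^ Suc k" for k
      using mult_right_mono[OF bnd[OF h[of k]], of "(1/2) ^ Suc k"] by (simp add: mult.commute)
  qed
  have part: "(\<Sum>k<m. (1/2) ^ Suc k *\<^sub>R h k) + (1/2) ^ m *\<^sub>R c \<in> C" if "c \<in> C" for m c
    using that
  proof (induction m arbitrary: c)
    case (Suc m)
    have "(1/2) *\<^sub>R h m + (1/2) *\<^sub>R c \<in> C" using Suc.prems h C(2) by (intro convexD) auto
    from Suc.IH[OF this] show ?case by (simp add: scaleR_right_distrib add.assoc)
  qed simp
  have "(\<lambda>m. (\<Sum>k<m. (1/2) ^ Suc k *\<^sub>R h k) + (1/2) ^ m *\<^sub>R h 0)
      \<longlonglongrightarrow> (\<Sum>k. (1/2) ^ Suc k *\<^sub>R h k) + 0 *\<^sub>R h 0"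
    by (intro tendsto_add summable_LIMSEQ[OF sm] tendsto_scaleR LIMSEQ_power_zero tendsto_const) auto
  then have "(\<Sum>k. (1/2) ^ Suc k *\<^sub>R h k) + 0 *\<^sub>R h 0 \<in> C"
    by (rule closed_sequentially[OF C(1), rotated]) (rule part[OF h])
  then show "(\<Sum>k. (1/2) ^ Suc k *\<^sub>R h k) \<in> C" by simp
qed

lemma weakly_compact_attains_sup:
  fixes f :: "'a::real_normed_vector \<Rightarrow>\<^sub>L real"
  assumes "compactin weak_top S" "S \<noteq> {}"
  obtains x where "x \<in> S" "\<And>y. y \<in> S \<Longrightarrow> blinfun_apply f y \<le> blinfun_apply f x"
proof -
  have "compactin euclideanreal (blinfun_apply f ` S)"
    using assms(1) by (rule image_compactin)
      (intro bounded_linear_continuous_map_weak blinfun.bounded_linear_right)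
  then have "compact (blinfun_apply f ` S)" by simp
  with compact_attains_sup[of "blinfun_apply f ` S"] assms(2)
  obtain t where "t \<in> blinfun_apply f ` S" "\<forall>u\<in>blinfun_apply f ` S. u \<le> t" by auto
  with that show thesis by blast
qed

text \<open>Simons' argument: build \<open>V = (\<Sum>k. h k / 2 ^ Suc k)\<close> choosing each \<open>h n \<in> C n\<close> so that the supremum
  over \<open>S\<close> of the partial sum is almost minimal. Comparing with the choice that would complete
  the partial sum to the midpoint of itself and \<open>V\<close> shows that, at a maximum point of \<open>V\<close>,
  all normalised tails (which lie in the \<open>C n\<close>) are almost as large as \<open>V\<close>.\<close>

lemma simons:
  fixes C :: "nat \<Rightarrow> ('a::real_normed_vector \<Rightarrow>\<^sub>L real) set"
  assumes S: "compactin weak_top S" "S \<noteq> {}"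
    and C: "\<And>n. closed (C n)" "\<And>n. convex (C n)" "\<And>n. C n \<noteq> {}" "decseq C"
    and bnd: "\<And>h. h \<in> C 0 \<Longrightarrow> norm h \<le> B"
    and small: "\<And>x \<eta>. x \<in> S \<Longrightarrow> 0 < \<eta> \<Longrightarrow> \<exists>n. \<forall>h\<in>C n. blinfun_apply h x \<le> \<eta>"
    and \<epsilon>: "0 < \<epsilon>"
  obtains V where "V \<in> C 0" "\<And>x. x \<in> S \<Longrightarrow> blinfun_apply V x \<le> \<epsilon>"
proof -
  define p where "p f = Sup (blinfun_apply f ` S)" for f :: "'a \<Rightarrow>\<^sub>L real"
  have attain: "\<exists>x\<in>S. p f = blinfun_apply f x" for f
  proof -
    obtain x where "x \<in> S" "\<And>y. y \<in> S \<Longrightarrow> blinfun_apply f y \<le> blinfun_apply f x"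
      using S by (rule weakly_compact_attains_sup[where f = f]) blast
    then show ?thesis unfolding p_def by (intro bexI[of _ x] cSup_eq_maximum) auto
  qed
  have upper: "blinfun_apply f x \<le> p f" if "x \<in> S" for f x
  proof -
    obtain y where "y \<in> S" "\<And>x. x \<in> S \<Longrightarrow> blinfun_apply f x \<le> blinfun_apply f y"
      using S by (rule weakly_compact_attains_sup[where f = f]) blast
    then show ?thesis unfolding p_def using that by (intro cSup_upper bdd_aboveI2[of _ _ "blinfun_apply f y"]) auto
  qed
  have bndn: "norm h \<le> B" if "h \<in> C n" for h n
    using bnd decseqD[OF C(4), of 0 n] that by auto
  \<comment> \<open>The factor \<open>1/4\<close> outweighs the later scaling:
    \<open>2 ^ Suc n * \<delta> n = \<epsilon> * (1/2) ^ Suc n\<close>, with total at most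
    \<open>\<epsilon>\<close>.\<close>
  define \<delta> where "\<delta> n = \<epsilon> * (1/4) ^ Suc n" for n
  have "\<exists>h\<in>C n. \<forall>g\<in>C n. p (v + (1/2) ^ Suc n *\<^sub>R h) \<le> p (v + (1/2) ^ Suc n *\<^sub>R g) + \<delta> n" for n v
  proof -
    let ?q = "\<lambda>h. p (v + (1/2) ^ Suc n *\<^sub>R h)"
    obtain x where x: "x \<in> S" using S(2) by blast
    \<comment> \<open>Evaluation at one point of \<open>S\<close> bounds the suprema from below, so
      a near minimiser exists.\<close>
    have low: "blinfun_apply v x - (1/2) ^ Suc n * (B * norm x) \<le> ?q h" if "h \<in> C n" for h
    proof -
      have "\<bar>blinfun_apply h x\<bar> \<le> B * norm x"
        using norm_blinfun[of h x] mult_right_mono[OF bndn[OF that] norm_ge_zero[of x]] by simp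
      then have "(1/2) ^ Suc n * (- (B * norm x)) \<le> (1/2) ^ Suc n * blinfun_apply h x"
        by (intro mult_left_mono) auto
      with upper[OF x, of "v + (1/2) ^ Suc n *\<^sub>R h"] show ?thesis
        by (simp add: blinfun.add_left blinfun.scaleR_left)
    qed
    then have bdd: "bdd_below (?q ` C n)" by (intro bdd_belowI2)
    have "Inf (?q ` C n) < Inf (?q ` C n) + \<delta> n" using \<epsilon> by (simp add: \<delta>_def)
    then obtain h where h: "h \<in> C n" "?q h < Inf (?q ` C n) + \<delta> n"
      using cInf_lessD[of "?q ` C n"] C(3) by blast
    moreover have "Inf (?q ` C n) \<le> ?q g" if "g \<in> C n" for g
      using that by (intro cINF_lower bdd)
    ultimately show ?thesis by (intro bexI[of _ h]) (auto intro: less_imp_le order_trans dest: less_le_trans)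
  qed
  then obtain H where H: "\<And>n v. H n v \<in> C n"
    and Hmin: "\<And>n v g. g \<in> C n \<Longrightarrow> p (v + (1/2) ^ Suc n *\<^sub>R H n v) \<le> p (v + (1/2) ^ Suc n *\<^sub>R g) + \<delta> n"
    by metis
  define v where "v = rec_nat 0 (\<lambda>n w. w + (1/2) ^ Suc n *\<^sub>R H n w)"
  have v0: "v 0 = 0" and vS: "v (Suc n) = v n + (1/2) ^ Suc n *\<^sub>R H n (v n)" for n
    by (simp_all add: v_def)
  define h where "h n = H n (v n)" for n
  have hC: "h k \<in> C n" if "n \<le> k" for n k
    using H[of k "v k"] decseqD[OF C(4) that] by (auto simp: h_def)
  have v: "v n = (\<Sum>k<n. (1/2) ^ Suc k *\<^sub>R h k)" for n
    by (induction n) (simp_all add: v0 vS h_def)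
  \<comment> \<open>The tail is rescaled so that its weights start again at \<open>1/2\<close>; this
    puts it in \<open>C n\<close>.\<close>
  define R where "R n = (\<Sum>k. (1/2) ^ Suc k *\<^sub>R h (k + n))" for n
  have R: "R n \<in> C n" and sm: "summable (\<lambda>k. (1/2) ^ Suc k *\<^sub>R h (k + n))" for n
    using halving_series_mem[OF C(1)[of n] C(2)[of n], of B "\<lambda>k. h (k + n)"] bndn[of _ n] hC[of n]
    by (simp_all add: R_def)
  define V where "V = R 0"
  have V: "V = v n + (1/2) ^ n *\<^sub>R R n" for n
  proof -
    have "V = (\<Sum>k. (1/2) ^ Suc (k + n) *\<^sub>R h (k + n)) + v n"
      using suminf_split_initial_segment[OF sm[of 0], of n] by (simp add: V_def R_def v)
    also have "(\<lambda>k. (1/2) ^ Suc (k + n) *\<^sub>R h (k + n)) = (\<lambda>k. (1/2) ^ n *\<^sub>R ((1/2) ^ Suc k *\<^sub>R h (k + n)))"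
      by (simp add: power_add mult.commute)
    also have "suminf \<dots> = (1/2) ^ n *\<^sub>R R n"
      unfolding R_def by (intro suminf_scaleR_right[symmetric] sm)
    finally show ?thesis by simp
  qed
  have step: "p (v (Suc n)) \<le> (p (v n) + p V) / 2 + \<delta> n" for n
  proof -
    have "p (v (Suc n)) \<le> p (v n + (1/2) ^ Suc n *\<^sub>R R n) + \<delta> n"
      unfolding vS by (rule Hmin[OF R])
    also have "v n + (1/2) ^ Suc n *\<^sub>R R n = (1/2) *\<^sub>R (v n + V)"
    proof -
      have "v n + V = 2 *\<^sub>R v n + (1/2) ^ n *\<^sub>R R n" unfolding V[of n] by (simp add: scaleR_2)
      then show ?thesis by (simp add: scaleR_right_distrib)
    qed
    also have "p ((1/2) *\<^sub>R (v n + V)) \<le> (p (v n) + p V) / 2"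
    proof -
      obtain x where "x \<in> S" "p ((1/2) *\<^sub>R (v n + V)) = blinfun_apply ((1/2) *\<^sub>R (v n + V)) x"
        using attain by blast
      with upper[of x "v n"] upper[of x V] show ?thesis
        by (simp add: blinfun.add_left blinfun.scaleR_left)
    qed
    finally show ?thesis by simp
  qed
  \<comment> \<open>The right-hand side starts at \<open>p V\<close>, because
    \<open>p 0 = 0\<close>, and the step from \<open>n\<close> to \<open>Suc n\<close> lowers it by
    at most \<open>\<epsilon> * (1/2) ^ Suc n\<close>.\<close>
  have gap: "p V - \<epsilon> + \<epsilon> * (1/2) ^ n \<le> 2 ^ n * (p V - p (v n))" for n
  proof (induction n)
    case 0
    have "p 0 = 0" using attain[of 0] by auto
    then show ?case by (simp add: v0)
  next
    case (Suc n)
    have "2 ^ Suc n * p (v (Suc n)) \<le> 2 ^ Suc n * ((p (v n) + p V) / 2 + \<delta> n)"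
      using step by (intro mult_left_mono) auto
    also have "\<dots> = 2 ^ n * p (v n) + 2 ^ n * p V + 2 ^ Suc n * \<delta> n"
      by (simp add: field_simps)
    also have "2 ^ Suc n * \<delta> n = \<epsilon> * (1/2) ^ Suc n"
    proof -
      have "(2 :: real) ^ Suc n * (1/4) ^ Suc n = (1/2) ^ Suc n"
        unfolding power_mult_distrib[symmetric] by simp
      then show ?thesis by (simp only: \<delta>_def mult.left_commute)
    qed
    finally show ?case using Suc.IH by (simp add: algebra_simps)
  qed
  obtain x where x: "x \<in> S" "p V = blinfun_apply V x" using attain by blast
  \<comment> \<open>Since \<open>R n\<close> is \<open>2 ^ n\<close> times \<open>V - v n\<close>,
    the estimate \<open>gap\<close> bounds it below at a maximum point of \<open>V\<close>.\<close>
  have tail: "p V - \<epsilon> \<le> blinfun_apply (R n) x" for n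
  proof -
    have "2 ^ n *\<^sub>R V = 2 ^ n *\<^sub>R v n + R n"
      unfolding V[of n] by (simp add: scaleR_right_distrib power_divide)
    from arg_cong[OF this, of "\<lambda>f. blinfun_apply f x"]
    have "blinfun_apply (R n) x = 2 ^ n * (p V - blinfun_apply (v n) x)"
      by (simp add: blinfun.add_left blinfun.scaleR_left x(2) algebra_simps)
    also have "\<dots> \<ge> 2 ^ n * (p V - p (v n))"
      using upper[OF x(1)] by (intro mult_left_mono) auto
    finally show ?thesis using gap[of n] \<epsilon> by (smt (verit) mult_nonneg_nonneg zero_le_power zero_le_divide_1_iff)
  qed
  have "p V - \<epsilon> \<le> 0"
  proof (rule field_le_epsilon)
    fix \<eta> :: real assume "0 < \<eta>"
    then obtain n where "\<forall>h\<in>C n. blinfun_apply h x \<le> \<eta>" using small[OF x(1)] by blast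
    with R[of n] tail[of n] show "p V - \<epsilon> \<le> 0 + \<eta>" by force
  qed
  with upper[of _ V] R[of 0] show thesis by (intro that[of V]) (force simp: V_def)+
qed

text \<open>Uniform boundedness via Baire's theorem in the dual: the closed sets \<open>A n\<close>
  cover it, so one of them contains a ball.\<close>

lemma bounded_if_weakly_bounded:
  fixes K :: "'a::real_normed_vector set"
  assumes "\<And>f :: 'a \<Rightarrow>\<^sub>L real. bounded (blinfun_apply f ` K)"
  shows "bounded K"
proof -
  define A where "A n = {f :: 'a \<Rightarrow>\<^sub>L real. \<forall>x\<in>K. \<bar>blinfun_apply f x\<bar> \<le> real n}" for n
  have "f \<in> (\<Union>n. A n)" for f
  proof -
    obtain B where "\<forall>x\<in>K. \<bar>blinfun_apply f x\<bar> \<le> B" using assms[of f] by (auto simp: bounded_iff)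
    then have "\<forall>x\<in>K. \<bar>blinfun_apply f x\<bar> \<le> real (nat \<lceil>B\<rceil>)" by (meson order_trans real_nat_ceiling_ge)
    then show ?thesis by (auto simp: A_def)
  qed
  then have cover: "(\<Union>n. A n) = UNIV" by blast
  have "closed (A n)" for n
  proof -
    have "A n = (\<Inter>x\<in>K. {f. \<bar>blinfun_apply f x\<bar> \<le> real n})" by (auto simp: A_def)
    also have "closed \<dots>" by (intro closed_INT ballI closed_Collect_le continuous_intros)
    finally show ?thesis .
  qed
  then have "\<exists>n. interior (A n) \<noteq> {}"
    using Baire_category_alt[of "euclidean :: ('a \<Rightarrow>\<^sub>L real) topology" "range A"] cover
    by (force simp: completely_metrizable_space_euclidean)
  then obtain n g r where r: "0 < r" "cball g r \<subseteq> A n" by (auto simp: mem_interior_cball)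
  \<comment> \<open>Compare the centre \<open>g\<close> with \<open>g + r *\<^sub>R f\<close>, where
    \<open>f\<close> norms \<open>x\<close>; both lie in \<open>A n\<close>.\<close>
  have "norm x \<le> 2 * real n / r" if "x \<in> K" for x
  proof -
    obtain f :: "'a \<Rightarrow>\<^sub>L real" where f: "norm f \<le> 1" "blinfun_apply f x = norm x" by (rule norming_functional)
    have "g \<in> A n" "g + r *\<^sub>R f \<in> A n"
      using r f(1) by (auto simp: subset_eq dist_norm)
    with that have "\<bar>blinfun_apply g x\<bar> \<le> n" "\<bar>blinfun_apply g x + r * norm x\<bar> \<le> n"
      by (auto simp: A_def blinfun.add_left blinfun.scaleR_left f(2))
    then have "r * norm x \<le> 2 * n" by linarith
    with r(1) show ?thesis by (simp add: field_simps)
  qed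
  then show ?thesis by (auto simp: bounded_iff)
qed

lemma weakly_compact_bounded:
  fixes K :: "'a::real_normed_vector set"
  assumes "compactin weak_top K"
  shows "bounded K"
proof (rule bounded_if_weakly_bounded)
  fix f :: "'a \<Rightarrow>\<^sub>L real"
  have "compactin euclideanreal (blinfun_apply f ` K)"
    using assms by (rule image_compactin)
      (intro bounded_linear_continuous_map_weak blinfun.bounded_linear_right)
  then show "bounded (blinfun_apply f ` K)" by (simp add: compact_imp_bounded)
qed

section \<open>Krein's theorem\<close>

text \<open>The values on a countable set form points of a countable product of compact intervals,
  whose sequential compactness replaces a diagonal extraction.\<close>

lemma pointwise_convergent_subsequence:
  fixes f :: "nat \<Rightarrow> ('a::real_normed_vector \<Rightarrow>\<^sub>L real)"
  assumes f: "\<And>m. norm (f m) \<le> 1" and A: "countable A"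
  obtains r where "strict_mono r" "\<And>x. x \<in> A \<Longrightarrow> convergent (\<lambda>m. blinfun_apply (f (r m)) x)"
proof (cases "A = {}")
  case True
  with that[of id] show thesis by (simp add: strict_mono_id)
next
  case False
  define e where "e = from_nat_into A"
  have e: "range e = A" unfolding e_def using False A by (rule range_from_nat_into)
  define u where "u m k = blinfun_apply (f m) (e k)" for m k
  let ?P = "PiE UNIV (\<lambda>k. {- norm (e k)..norm (e k)})"
  have "compactin (product_topology (\<lambda>_. euclideanreal) UNIV) ?P" by (simp add: compactin_PiE)
  then have "compact ?P" by (simp add: euclidean_product_topology)
  then have seq: "seq_compact ?P" by (rule compact_imp_seq_compact)
  have "\<forall>m. u m \<in> ?P"
  proof
    fix m
    have "\<bar>u m k\<bar> \<le> norm (e k)" for k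
      using norm_blinfun[of "f m" "e k"] mult_right_mono[OF f[of m] norm_ge_zero[of "e k"]]
      by (simp add: u_def)
    then show "u m \<in> ?P" by (auto simp: PiE_iff abs_le_iff minus_le_iff)
  qed
  with seq obtain l r where r: "strict_mono r" and l: "(u \<circ> r) \<longlonglongrightarrow> l"
    unfolding seq_compact_def by metis
  have "convergent (\<lambda>m. blinfun_apply (f (r m)) (e k))" for k
  proof -
    have "(\<lambda>m. (u \<circ> r) m k) \<longlonglongrightarrow> l k"
      by (rule continuous_on_tendsto_compose[OF continuous_on_product_coordinates l]) auto
    then show ?thesis by (auto simp: u_def convergent_def comp_def)
  qed
  with r e that show thesis by blast
qed

text \<open>The uniform norm bound transfers the Cauchy property from nearby points. A closed
  subspace is weakly closed, so intersecting it with \<open>K\<close> keeps weak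
  compactness.\<close>

lemma closed_subspace_convergent:
  fixes g :: "nat \<Rightarrow> ('a::real_normed_vector \<Rightarrow>\<^sub>L real)"
  assumes g: "\<And>m. norm (g m) \<le> 1"
  shows "subspace {x. convergent (\<lambda>m. blinfun_apply (g m) x)}"
    and "closed {x. convergent (\<lambda>m. blinfun_apply (g m) x)}"
proof -
  let ?Y = "{x. convergent (\<lambda>m. blinfun_apply (g m) x)}"
  show "subspace ?Y"
    by (auto simp: subspace_def blinfun.add_right blinfun.scaleR_right
        intro: convergent_add convergent_mult convergent_const)
  have "x \<in> ?Y" if x: "x \<in> closure ?Y" for x
  proof -
    have "Cauchy (\<lambda>m. blinfun_apply (g m) x)"
    proof (rule metric_CauchyI)
      fix e :: real assume e: "0 < e"
      obtain y where y: "y \<in> ?Y" "dist y x < e / 4" using x e by (meson closure_approachable zero_less_divide_iff zero_less_numeral)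
      have near: "\<bar>blinfun_apply (g m) x - blinfun_apply (g m) y\<bar> < e / 4" for m
      proof -
        have "\<bar>blinfun_apply (g m) (x - y)\<bar> \<le> 1 * norm (x - y)"
          using norm_blinfun[of "g m" "x - y"] mult_right_mono[OF g[of m] norm_ge_zero[of "x - y"]] by simp
        with y(2) show ?thesis by (simp add: blinfun.diff_right dist_norm norm_minus_commute)
      qed
      have "Cauchy (\<lambda>m. blinfun_apply (g m) y)" using y(1) by (simp add: convergent_Cauchy)
      then obtain M where M: "\<And>m n. m \<ge> M \<Longrightarrow> n \<ge> M \<Longrightarrow> dist (blinfun_apply (g m) y) (blinfun_apply (g n) y) < e / 4"
        using e by (meson metric_CauchyD zero_less_divide_iff zero_less_numeral)
      have "dist (blinfun_apply (g m) x) (blinfun_apply (g n) x) < e" if "m \<ge> M" "n \<ge> M" for m n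
        using M[OF that] near[of m] near[of n] e unfolding dist_real_def by linarith
      then show "\<exists>M. \<forall>m\<ge>M. \<forall>n\<ge>M. dist (blinfun_apply (g m) x) (blinfun_apply (g n) x) < e" by blast
    qed
    then show ?thesis by (simp add: Cauchy_convergent_iff)
  qed
  then show "closed ?Y" by (metis closure_subset closure_eq subsetI subset_antisym)
qed

lemma convex_halfspace_blinfun_le: "convex {x. blinfun_apply f x \<le> (c::real)}"
  using convex_linear_vimage[OF bounded_linear.linear[OF blinfun.bounded_linear_right[of f]], of "{..c}"]
  by (auto simp: vimage_def)

lemma convex_eval_le: "convex {f. blinfun_apply f x \<le> (c::real)}"
  and convex_eval_ge: "convex {f. c \<le> blinfun_apply f x}"
  using convex_linear_vimage[OF bounded_linear.linear[OF blinfun.bounded_linear_left[of x]], of "{..c}"]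
    convex_linear_vimage[OF bounded_linear.linear[OF blinfun.bounded_linear_left[of x]], of "{c..}"]
  by (auto simp: vimage_def)

text \<open>Restricts attention to countably many points of \<open>K\<close>, on which a subsequence
  of functionals can be made to converge.\<close>

lemma countable_convex_support:
  assumes "\<And>n::nat. z n \<in> convex hull K"
  obtains A where "countable A" "A \<subseteq> K" "\<And>n. z n \<in> convex hull A"
proof -
  have "\<exists>S. finite S \<and> S \<subseteq> K \<and> z n \<in> convex hull S" for n
  proof -
    obtain S u where S: "finite S" "S \<subseteq> K" "\<forall>x\<in>S. 0 \<le> u x" "sum u S = 1" "sum (\<lambda>v. u v *\<^sub>R v) S = z n"
      using assms[of n] unfolding convex_hull_explicit by blast
    have "z n \<in> convex hull S"
      unfolding convex_hull_explicit using S by blast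
    with S show ?thesis by blast
  qed
  then obtain S where S: "\<And>n. finite (S n)" "\<And>n. S n \<subseteq> K" "\<And>n. z n \<in> convex hull (S n)" by metis
  show thesis
  proof (rule that)
    show "countable (\<Union>n. S n)" by (rule countable_UN) (auto intro: countable_finite S(1))
    show "(\<Union>n. S n) \<subseteq> K" using S(2) by blast
    show "z n \<in> convex hull (\<Union>n. S n)" for n using S(3)[of n] hull_mono[of "S n" "\<Union>n. S n"] by blast
  qed
qed

text \<open>A subsequence \<open>g\<close> of \<open>f\<close> converges on a countable set
  supporting all \<open>z n\<close>, and its limit \<open>\<phi>\<close> vanishes at every
  \<open>z n\<close>. Simons' lemma gives a limit of convex combinations of the
  \<open>g m - \<phi>\<close> that is at most \<open>\<theta> / 4\<close> at all \<open>z n\<close>.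
  A finite combination close to it is still at least \<open>\<theta>\<close> at \<open>z N\<close>
  for large \<open>N\<close>.\<close>

lemma no_triangular_gap:
  fixes K :: "'a::real_normed_vector set" and f :: "nat \<Rightarrow> ('a \<Rightarrow>\<^sub>L real)"
  assumes K: "compactin weak_top K" and z: "\<And>n. z n \<in> convex hull K"
    and f: "\<And>m. norm (f m) \<le> 1" and \<theta>: "0 < \<theta>"
    and low: "\<And>m n. m \<le> n \<Longrightarrow> \<theta> \<le> blinfun_apply (f m) (z n)"
    and zero: "\<And>m n. n < m \<Longrightarrow> blinfun_apply (f m) (z n) = 0"
  shows False
proof -
  obtain A where A: "countable A" "A \<subseteq> K" "\<And>n. z n \<in> convex hull A"
    using countable_convex_support[of z K] z by blast
  obtain r where r: "strict_mono r" and conv: "\<And>x. x \<in> A \<Longrightarrow> convergent (\<lambda>m. blinfun_apply (f (r m)) x)"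
    using pointwise_convergent_subsequence[of f A] f A(1) by blast
  define g where "g m = f (r m)" for m
  have g: "norm (g m) \<le> 1" for m by (simp add: g_def f)
  define Y where "Y = {x. convergent (\<lambda>m. blinfun_apply (g m) x)}"
  have subY: "subspace Y" and closedY: "closed Y"
    unfolding Y_def by (intro closed_subspace_convergent g)+
  have AY: "A \<subseteq> Y" using conv by (auto simp: Y_def g_def)
  define L where "L x = lim (\<lambda>m. blinfun_apply (g m) x)" for x
  have L: "(\<lambda>m. blinfun_apply (g m) x) \<longlonglongrightarrow> L x" if "x \<in> Y" for x
    using that by (simp add: Y_def L_def convergent_LIMSEQ_iff)
  obtain \<phi> :: "'a \<Rightarrow>\<^sub>L real" where \<phi>: "norm \<phi> \<le> 1" "\<And>x. x \<in> Y \<Longrightarrow> blinfun_apply \<phi> x = L x"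
  proof (rule hahn_banach_extension[OF subY, of 1 L])
    fix x y assume xy: "x \<in> Y" "y \<in> Y"
    show "L (x + y) = L x + L y"
      using tendsto_add[OF L[OF xy(1)] L[OF xy(2)]] L[OF subspace_add[OF subY xy]]
      by (simp add: blinfun.add_right LIMSEQ_unique)
  next
    fix c x assume x: "x \<in> Y"
    show "L (c *\<^sub>R x) = c * L x"
      using tendsto_mult_left[OF L[OF x], of c] L[OF subspace_scale[OF subY x], of c]
      by (simp add: blinfun.scaleR_right LIMSEQ_unique)
  next
    fix x assume x: "x \<in> Y"
    have "blinfun_apply (g m) x \<le> 1 * norm x" for m
      using norm_blinfun[of "g m" x] mult_right_mono[OF g[of m] norm_ge_zero[of x]] by simp
    then show "L x \<le> 1 * norm x" using L[OF x] by (meson LIMSEQ_le_const2)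
  qed auto
  define S where "S = K \<inter> Y"
  have S: "compactin weak_top S"
    unfolding S_def using K closedY subY
    by (intro compact_Int_closedin closedin_weak_convex) (auto simp: subspace_imp_convex)
  have "A \<subseteq> S" using A(2) AY by (simp add: S_def)
  have "S \<noteq> {}" using A(3)[of 0] \<open>A \<subseteq> S\<close> by auto
  define G where "G n = (\<lambda>m. g m - \<phi>) ` {n..}" for n
  have G_cball: "G n \<subseteq> cball 0 2" for n
  proof -
    have "norm (g m - \<phi>) \<le> 2" for m
      using norm_triangle_ineq4[of "g m" \<phi>] g[of m] \<phi>(1) by linarith
    then show ?thesis by (auto simp: G_def)
  qed
  obtain V where V: "V \<in> closure (convex hull (G 0))" and VS: "\<And>x. x \<in> S \<Longrightarrow> blinfun_apply V x \<le> \<theta> / 4"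
  proof (rule simons[OF S \<open>S \<noteq> {}\<close>, of "\<lambda>n. closure (convex hull (G n))" 2 "\<theta> / 4"])
    show "decseq (\<lambda>n. closure (convex hull (G n)))"
      by (intro decseq_SucI closure_mono hull_mono) (auto simp: G_def)
    show "norm h \<le> 2" if "h \<in> closure (convex hull (G 0))" for h
    proof -
      have "closure (convex hull (G 0)) \<subseteq> cball 0 2"
        by (intro closure_minimal hull_minimal G_cball) auto
      with that show ?thesis by auto
    qed
    fix x and \<eta> :: real assume x: "x \<in> S" and \<eta>: "0 < \<eta>"
    have "(\<lambda>m. blinfun_apply (g m) x) \<longlonglongrightarrow> blinfun_apply \<phi> x"
      using x L \<phi>(2) by (simp add: S_def)
    then have "\<forall>\<^sub>F m in sequentially. blinfun_apply (g m) x < blinfun_apply \<phi> x + \<eta>"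
      using \<eta> by (intro order_tendstoD) auto
    then obtain n where n: "\<And>m. m \<ge> n \<Longrightarrow> blinfun_apply (g m) x < blinfun_apply \<phi> x + \<eta>"
      by (auto simp: eventually_sequentially)
    have "closure (convex hull (G n)) \<subseteq> {h. blinfun_apply h x \<le> \<eta>}"
    proof (intro closure_minimal hull_minimal convex_eval_le)
      show "G n \<subseteq> {h. blinfun_apply h x \<le> \<eta>}"
        using n by (force simp: G_def blinfun.diff_left)
      show "closed {h. blinfun_apply h x \<le> \<eta>}"
        by (intro closed_Collect_le continuous_intros)
    qed
    then show "\<exists>n. \<forall>h\<in>closure (convex hull (G n)). blinfun_apply h x \<le> \<eta>" by blast
  qed (use \<theta> in \<open>auto simp: G_def intro: convex_closure\<close>)
  have Vz: "blinfun_apply V (z n) \<le> \<theta> / 4" for n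
  proof -
    have "convex hull A \<subseteq> {x. blinfun_apply V x \<le> \<theta> / 4}"
      using VS \<open>A \<subseteq> S\<close> by (intro hull_minimal convex_halfspace_blinfun_le) auto
    with A(3) show ?thesis by blast
  qed
  have \<phi>z: "blinfun_apply \<phi> (z n) = 0" for n
  proof -
    have "convex hull A \<subseteq> Y" using AY subY by (intro hull_minimal) (auto simp: subspace_imp_convex)
    then have "z n \<in> Y" using A(3) by blast
    moreover have "\<forall>\<^sub>F m in sequentially. blinfun_apply (g m) (z n) = 0"
      using seq_suble[OF r] by (intro eventually_sequentiallyI[of "Suc n"])
        (auto simp: g_def intro!: zero intro: less_le_trans)
    then have "(\<lambda>m. blinfun_apply (g m) (z n)) \<longlonglongrightarrow> 0" by (simp add: tendsto_eventually)
    ultimately show ?thesis using LIMSEQ_unique[OF L[of "z n"]] \<phi>(2)[of "z n"] by simp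
  qed
  obtain B where B: "0 < B" "\<And>x. x \<in> K \<Longrightarrow> norm x \<le> B"
    using weakly_compact_bounded[OF K] by (auto simp: bounded_pos)
  have "convex hull K \<subseteq> cball 0 B" using B(2) by (intro hull_minimal) auto
  then have zB: "norm (z n) \<le> B" for n using z[of n] by (auto simp: subset_eq)
  \<comment> \<open>As \<open>norm (z n) \<le> B\<close>, replacing \<open>V\<close> by
    \<open>h\<close> changes its values at the \<open>z n\<close> by at most
    \<open>\<theta> / 4\<close>.\<close>
  obtain h where h: "h \<in> convex hull (G 0)" "dist h V < \<theta> / (4 * B)"
    using V \<theta> B(1) by (meson closure_approachable divide_pos_pos mult_pos_pos zero_less_numeral)
  obtain W where W: "finite W" "W \<subseteq> G 0" "h \<in> convex hull W"
  proof -
    obtain W u where W: "finite W" "W \<subseteq> G 0" "\<forall>x\<in>W. 0 \<le> u x" "sum u W = 1" "sum (\<lambda>v. u v *\<^sub>R v) W = h"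
      using h(1) unfolding convex_hull_explicit by blast
    have "h \<in> convex hull W"
      unfolding convex_hull_explicit using W by blast
    with W that show thesis by blast
  qed
  obtain I where I: "finite I" "W = (\<lambda>m. g m - \<phi>) ` I"
    using finite_subset_image[OF W(1), of "\<lambda>m. g m - \<phi>" "{0..}"] W(2) by (auto simp: G_def)
  \<comment> \<open>All original indices \<open>r m\<close> with \<open>m \<in> I\<close> are at
    most \<open>N\<close>, so \<open>low\<close> applies to each; the inserted \<open>0\<close>
    keeps \<open>Max\<close> meaningful without checking that \<open>I\<close> is nonempty.\<close>
  define N where "N = r (Max (insert 0 I))"
  have "convex hull W \<subseteq> {h. \<theta> \<le> blinfun_apply h (z N)}"
  proof (intro hull_minimal convex_eval_ge)
    have "\<theta> \<le> blinfun_apply (g m) (z N)" if "m \<in> I" for m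
      unfolding g_def
    proof (rule low)
      have "m \<le> Max (insert 0 I)" using that I(1) by simp
      then show "r m \<le> N" unfolding N_def using r by (simp add: strict_mono_less_eq)
    qed
    then show "W \<subseteq> {h. \<theta> \<le> blinfun_apply h (z N)}" by (auto simp: I(2) blinfun.diff_left \<phi>z)
  qed
  with W(3) have "\<theta> \<le> blinfun_apply h (z N)" by blast
  also have "\<dots> = blinfun_apply V (z N) + blinfun_apply (h - V) (z N)" by (simp add: blinfun.diff_left)
  also have "blinfun_apply (h - V) (z N) \<le> norm (h - V) * norm (z N)"
    using norm_blinfun[of "h - V" "z N"] by simp
  also have "\<dots> \<le> \<theta> / (4 * B) * B"
    using h(2) zB B(1) \<theta> by (intro mult_mono) (auto simp: dist_norm)
  also have "\<dots> = \<theta> / 4" using B(1) by simp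
  finally show False using Vz[of N] \<theta> by simp
qed

text \<open>Induction on \<open>E\<close>. Either \<open>x\<close> imposes no new condition on the
  annihilator of \<open>E\<close>, or subtracting a multiple of evaluation at \<open>x\<close>
  reduces to \<open>E\<close>.\<close>

lemma vanishing_on_annihilator_is_evaluation:
  fixes F :: "('a::real_normed_vector \<Rightarrow>\<^sub>L real) \<Rightarrow> real"
  assumes "finite E" "linear F" "\<And>f. (\<forall>x\<in>E. blinfun_apply f x = 0) \<Longrightarrow> F f = 0"
  shows "\<exists>e. \<forall>f. F f = blinfun_apply f e"
  using assms
proof (induction E arbitrary: F)
  case empty
  then show ?case by (auto intro!: exI[of _ 0])
next
  case (insert x E)
  show ?case
  proof (cases "\<exists>g :: 'a \<Rightarrow>\<^sub>L real. (\<forall>y\<in>E. blinfun_apply g y = 0) \<and> blinfun_apply g x \<noteq> 0")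
    case False
    show ?thesis
    proof (rule insert.IH[OF insert.prems(1)])
      fix f :: "'a \<Rightarrow>\<^sub>L real" assume f: "\<forall>y\<in>E. blinfun_apply f y = 0"
      with False have "blinfun_apply f x = 0" by blast
      with f show "F f = 0" by (intro insert.prems(2)) simp
    qed
  next
    case True
    then obtain g :: "'a \<Rightarrow>\<^sub>L real" where g: "\<And>y. y \<in> E \<Longrightarrow> blinfun_apply g y = 0" "blinfun_apply g x \<noteq> 0" by blast
    \<comment> \<open>With this \<open>c\<close> the corrected functional vanishes at
      \<open>g\<close>, and every \<open>f\<close> annihilating \<open>E\<close> is a multiple of
      \<open>g\<close> plus a functional that also vanishes at \<open>x\<close>.\<close>
    define c where "c = F g / blinfun_apply g x"
    have "\<exists>e. \<forall>f. F f - c * blinfun_apply f x = blinfun_apply f e"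
    proof (rule insert.IH)
      show "linear (\<lambda>f. F f - c * blinfun_apply f x)"
        using insert.prems(1)
        by (intro linearI) (auto simp: linear_add linear_scale blinfun.add_left blinfun.scaleR_left algebra_simps)
      fix f :: "'a \<Rightarrow>\<^sub>L real" assume f: "\<forall>y\<in>E. blinfun_apply f y = 0"
      define d where "d = blinfun_apply f x / blinfun_apply g x"
      have "F (f - d *\<^sub>R g) = 0"
        using f g by (intro insert.prems(2)) (auto simp: blinfun.diff_left blinfun.scaleR_left d_def)
      then show "F f - c * blinfun_apply f x = 0"
        using insert.prems(1) by (simp add: linear_diff linear_scale c_def d_def)
    qed
    then obtain e where e: "\<And>f. F f - c * blinfun_apply f x = blinfun_apply f e" by blast
    have "F f = blinfun_apply f (e + c *\<^sub>R x)" for f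
      using e[of f] by (simp add: blinfun.add_right blinfun.scaleR_right diff_eq_eq)
    then show ?thesis by blast
  qed
qed

text \<open>The restriction of \<open>F\<close> to the annihilator of \<open>E\<close> extends to
  some \<open>G\<close> with norm at most \<open>\<theta>\<close>. The difference of
  \<open>F\<close> and \<open>G\<close> vanishes on that annihilator, so it is an
  evaluation.\<close>

lemma helly:
  fixes F :: "('a::real_normed_vector \<Rightarrow>\<^sub>L real) \<Rightarrow> real"
  assumes F: "linear F" and E: "finite E" and \<theta>: "0 \<le> \<theta>"
    and le: "\<And>f. (\<forall>x\<in>E. blinfun_apply f x = 0) \<Longrightarrow> F f \<le> \<theta> * norm f"
  shows "\<exists>e. \<forall>f. \<bar>F f - blinfun_apply f e\<bar> \<le> \<theta> * norm f"
proof -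
  define M where "M = {f :: 'a \<Rightarrow>\<^sub>L real. \<forall>x\<in>E. blinfun_apply f x = 0}"
  have M: "subspace M" by (auto simp: M_def subspace_def blinfun.add_left blinfun.scaleR_left)
  obtain G where G: "norm G \<le> \<theta>" "\<And>f. f \<in> M \<Longrightarrow> blinfun_apply G f = F f"
    using F le by (elim hahn_banach_extension[OF M \<theta>, of F, rotated 3]) (auto simp: M_def linear_add linear_scale)
  have "\<exists>e. \<forall>f. F f - blinfun_apply G f = blinfun_apply f e"
  proof (rule vanishing_on_annihilator_is_evaluation[OF E])
    show "linear (\<lambda>f. F f - blinfun_apply G f)"
      using F by (intro linearI) (auto simp: linear_add linear_scale blinfun.add_right blinfun.scaleR_right algebra_simps)
  qed (use G(2) in \<open>auto simp: M_def\<close>)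
  then obtain e where e: "\<And>f. F f - blinfun_apply G f = blinfun_apply f e" by blast
  have "\<bar>F f - blinfun_apply f e\<bar> \<le> \<theta> * norm f" for f
    using e[of f] norm_blinfun[of G f] mult_right_mono[OF G(1) norm_ge_zero[of f]] by simp
  then show ?thesis by blast
qed

text \<open>Norming functionals turn closeness of evaluations into closeness of vectors, so the
  approximating vectors are Cauchy and converge by completeness.\<close>

lemma evaluation_if_approximable:
  fixes F :: "('a::banach \<Rightarrow>\<^sub>L real) \<Rightarrow> real"
  assumes "\<And>\<theta>. 0 < \<theta> \<Longrightarrow> \<exists>e. \<forall>f. \<bar>F f - blinfun_apply f e\<bar> \<le> \<theta> * norm f"
  shows "\<exists>x. \<forall>f. F f = blinfun_apply f x"
proof -
  define \<theta> where "\<theta> n = inverse (real (Suc n))" for n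
  have "\<forall>n. \<exists>e. \<forall>f. \<bar>F f - blinfun_apply f e\<bar> \<le> \<theta> n * norm f"
    using assms by (simp add: \<theta>_def)
  then obtain e where e: "\<And>n f. \<bar>F f - blinfun_apply f (e n)\<bar> \<le> \<theta> n * norm f" by metis
  have \<theta>: "\<theta> \<longlonglongrightarrow> 0" unfolding \<theta>_def by (rule LIMSEQ_inverse_real_of_nat)
  have pos: "0 \<le> \<theta> n" for n by (simp add: \<theta>_def)
  have dist: "norm (e m - e n) \<le> \<theta> m + \<theta> n" for m n
  proof -
    obtain f :: "'a \<Rightarrow>\<^sub>L real" where f: "norm f \<le> 1" "blinfun_apply f (e m - e n) = norm (e m - e n)"
      by (rule norming_functional)
    have "\<theta> k * norm f \<le> \<theta> k" for k using mult_left_mono[OF f(1) pos[of k]] by simp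
    then have "\<bar>F f - blinfun_apply f (e k)\<bar> \<le> \<theta> k" for k using e[of f k] by (rule order_trans[rotated])
    from this[of m] this[of n] f(2) show ?thesis by (simp add: blinfun.diff_right)
  qed
  have "Cauchy e"
  proof (rule CauchyI)
    fix r :: real assume "0 < r"
    then have "\<forall>\<^sub>F n in sequentially. \<theta> n < r / 2" using \<theta> by (intro order_tendstoD) auto
    then obtain N where N: "\<And>n. n \<ge> N \<Longrightarrow> \<theta> n < r / 2" by (auto simp: eventually_sequentially)
    have "norm (e m - e n) < r" if "N \<le> m" "N \<le> n" for m n
      using dist[of m n] N[OF that(1)] N[OF that(2)] by linarith
    then show "\<exists>M. \<forall>m\<ge>M. \<forall>n\<ge>M. norm (e m - e n) < r" by blast
  qed
  then obtain x where x: "e \<longlonglongrightarrow> x" by (auto simp: Cauchy_convergent_iff convergent_def)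
  have "F f = blinfun_apply f x" for f
  proof -
    have "(\<lambda>n. blinfun_apply f (e n)) \<longlonglongrightarrow> blinfun_apply f x" by (intro tendsto_intros x)
    moreover have "(\<lambda>n. blinfun_apply f (e n)) \<longlonglongrightarrow> F f"
    proof (rule LIM_zero_cancel, rule Lim_null_comparison)
      show "\<forall>\<^sub>F n in sequentially. norm (blinfun_apply f (e n) - F f) \<le> \<theta> n * norm f"
        using e[of f] by (simp add: abs_minus_commute)
      show "(\<lambda>n. \<theta> n * norm f) \<longlonglongrightarrow> 0" using tendsto_mult_right[OF \<theta>, of "norm f"] by simp
    qed
    ultimately show ?thesis by (metis LIMSEQ_unique)
  qed
  then show ?thesis by blast
qed

lemma pointwise_closure_approx:
  fixes F :: "'i \<Rightarrow> real"
  assumes "F \<in> closure S" "finite I" "0 < \<epsilon>"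
  obtains G where "G \<in> S" "\<And>i. i \<in> I \<Longrightarrow> \<bar>G i - F i\<bar> < \<epsilon>"
proof -
  let ?U = "\<Inter>i\<in>I. {G. \<bar>G i - F i\<bar> < \<epsilon>}"
  have "open ?U" using assms(2) by (intro open_INT ballI open_Collect_less continuous_intros) auto
  moreover have "F \<in> ?U \<inter> closure S" using assms by auto
  ultimately have "?U \<inter> S \<noteq> {}" using open_Int_closure_eq_empty by blast
  with that show thesis by blast
qed

text \<open>If \<open>F\<close> is not an evaluation, Helly's lemma and the pointwise approximation of \<open>F\<close> by \<open>convex hull K\<close>
  alternately produce the functionals and vectors excluded by \<open>no_triangular_gap\<close>.\<close>

lemma pointwise_closure_hull_is_evaluation:
  fixes K :: "'a::banach set" and F :: "('a \<Rightarrow>\<^sub>L real) \<Rightarrow> real"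
  assumes K: "compactin weak_top K" and lin: "linear F"
    and F: "F \<in> closure ((\<lambda>x f. blinfun_apply f x) ` (convex hull K))"
  shows "\<exists>x. \<forall>f. F f = blinfun_apply f x"
proof (rule ccontr)
  assume "\<not> ?thesis"
  with evaluation_if_approximable[of F] obtain \<theta> where \<theta>: "0 < \<theta>"
    and far: "\<not> (\<exists>e. \<forall>f. \<bar>F f - blinfun_apply f e\<bar> \<le> \<theta> * norm f)" by blast
  have functional: "\<exists>f. norm f \<le> 1 \<and> \<theta> < F f \<and> (\<forall>x\<in>E. blinfun_apply f x = 0)" if "finite E" for E
  proof -
    have "\<exists>f. (\<forall>x\<in>E. blinfun_apply f x = 0) \<and> \<theta> * norm f < F f"
      using helly[OF lin that, of \<theta>] \<theta> far by (meson less_imp_le not_le)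
    then obtain f where f: "\<forall>x\<in>E. blinfun_apply f x = 0" "\<theta> * norm f < F f" by blast
    have "norm f \<noteq> 0" using f(2) lin by (auto simp: linear_0)
    then have "\<theta> < F ((1 / norm f) *\<^sub>R f)"
      using f(2) by (simp add: linear_scale[OF lin] field_simps)
    then show ?thesis using f(1) \<open>norm f \<noteq> 0\<close>
      by (intro exI[of _ "(1 / norm f) *\<^sub>R f"]) (auto simp: blinfun.scaleR_left)
  qed
  have vector: "\<exists>z\<in>convex hull K. \<forall>f\<in>I. \<bar>blinfun_apply f z - F f\<bar> < \<theta> / 2" if fin: "finite I" for I
  proof -
    obtain G where "G \<in> (\<lambda>x f. blinfun_apply f x) ` (convex hull K)" "\<And>f. f \<in> I \<Longrightarrow> \<bar>G f - F f\<bar> < \<theta> / 2"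
      using pointwise_closure_approx[OF F fin half_gt_zero[OF \<theta>]] by blast
    then show ?thesis by auto
  qed
  \<comment> \<open>Stage \<open>n\<close> picks a pair: a functional killing all earlier vectors,
    and a vector approximating \<open>F\<close> on all functionals so far. Only earlier entries of
    \<open>s\<close> are consulted, as the recursive choice requires.\<close>
  define P where "P s n t \<longleftrightarrow> norm (fst t) \<le> 1 \<and> \<theta> < F (fst t) \<and> snd t \<in> convex hull K
      \<and> (\<forall>k<n. blinfun_apply (fst t) (snd (s k)) = 0)
      \<and> (\<forall>k<n. \<bar>blinfun_apply (fst (s k)) (snd t) - F (fst (s k))\<bar> < \<theta> / 2)
      \<and> \<bar>blinfun_apply (fst t) (snd t) - F (fst t)\<bar> < \<theta> / 2"
    for s :: "nat \<Rightarrow> ('a \<Rightarrow>\<^sub>L real) \<times> 'a" and n t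
  have "\<exists>s. \<forall>n. P s n (s n)"
  proof (rule dependent_wellorder_choice)
    show "P s n t = P s' n t" if "\<And>k. k < n \<Longrightarrow> s k = s' k" for t s s' and n :: nat
      using that by (simp add: P_def)
  next
    fix n :: nat and s :: "nat \<Rightarrow> ('a \<Rightarrow>\<^sub>L real) \<times> 'a"
    obtain f where f: "norm f \<le> 1" "\<theta> < F f" "\<forall>x\<in>(\<lambda>k. snd (s k)) ` {..<n}. blinfun_apply f x = 0"
      using functional[of "(\<lambda>k. snd (s k)) ` {..<n}"] finite_lessThan[of n] by blast
    \<comment> \<open>The new \<open>f\<close> joins the test set to cover the diagonal case
      \<open>m = n\<close>.\<close>
    obtain z where "z \<in> convex hull K"
      "\<forall>g\<in>insert f ((\<lambda>k. fst (s k)) ` {..<n}). \<bar>blinfun_apply g z - F g\<bar> < \<theta> / 2"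
      using vector[of "insert f ((\<lambda>k. fst (s k)) ` {..<n})"] finite_lessThan[of n] by blast
    with f show "\<exists>t. P s n t" by (intro exI[of _ "(f, z)"]) (auto simp: P_def)
  qed
  then obtain s where s: "\<And>n. P s n (s n)" by blast
  define f where "f n = fst (s n)" for n
  define z where "z n = snd (s n)" for n
  show False
  proof (rule no_triangular_gap[OF K, of z f "\<theta> / 2"])
    show "z n \<in> convex hull K" "norm (f n) \<le> 1" for n
      using s[of n] by (auto simp: P_def f_def z_def)
    show "blinfun_apply (f m) (z n) = 0" if "n < m" for m n
      using s[of m] that by (auto simp: P_def f_def z_def)
    fix m n :: nat assume "m \<le> n"
    then have "\<bar>blinfun_apply (f m) (z n) - F (f m)\<bar> < \<theta> / 2"
      using s[of n] by (cases "m = n") (auto simp: P_def f_def z_def)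
    moreover have "\<theta> < F (f m)" using s[of m] by (auto simp: P_def f_def)
    ultimately show "\<theta> / 2 \<le> blinfun_apply (f m) (z n)" by linarith
  qed (use \<theta> in simp)
qed

text \<open>In the product of lines indexed by the dual, the closure \<open>D\<close> of the
  embedded hull is compact by Tychonoff's theorem and consists of evaluations. Pulling it back by
  \<open>inv \<Phi>\<close> gives a weakly compact set containing the hull.\<close>

theorem krein:
  fixes K :: "'a::banach set"
  assumes K: "compactin weak_top K"
  shows "compactin weak_top (weak_top closure_of (convex hull K))"
proof -
  define \<Phi> :: "'a \<Rightarrow> ('a \<Rightarrow>\<^sub>L real) \<Rightarrow> real" where "\<Phi> x f = blinfun_apply f x" for x f
  define D where "D = closure (\<Phi> ` (convex hull K))"
  obtain B where B: "\<And>x. x \<in> K \<Longrightarrow> norm x \<le> B"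
    using weakly_compact_bounded[OF K] by (auto simp: bounded_iff)
  let ?P = "PiE UNIV (\<lambda>f :: 'a \<Rightarrow>\<^sub>L real. {- (norm f * B)..norm f * B})"
  have "convex hull K \<subseteq> cball 0 B" using B by (intro hull_minimal) auto
  have "\<bar>\<Phi> x f\<bar> \<le> norm f * B" if "x \<in> convex hull K" for x f
  proof -
    have "norm x \<le> B" using that \<open>convex hull K \<subseteq> cball 0 B\<close> by (auto simp: subset_eq)
    then show ?thesis using norm_blinfun[of f x] mult_left_mono[of "norm x" B "norm f"]
      by (simp add: \<Phi>_def)
  qed
  then have "\<Phi> ` (convex hull K) \<subseteq> ?P" by (auto simp: PiE_iff abs_le_iff minus_le_iff)
  moreover have P: "?P = {F. \<forall>f. - (norm f * B) \<le> F f \<and> F f \<le> norm f * B}" by (auto simp: PiE_iff)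
  have "closed ?P" unfolding P
    by (intro closed_Collect_all closed_Collect_conj closed_Collect_le continuous_intros) auto
  ultimately have "D \<subseteq> ?P" unfolding D_def by (rule closure_minimal)
  have "compactin (product_topology (\<lambda>_. euclideanreal) UNIV) ?P" by (simp add: compactin_PiE)
  then have "compact ?P" by (simp add: euclidean_product_topology)
  then have "compact (?P \<inter> D)" by (rule compact_Int_closed) (simp add: D_def)
  with \<open>D \<subseteq> ?P\<close> have compD: "compact D" by (simp add: Int_absorb1)
  \<comment> \<open>The linearity identities are closed conditions for pointwise convergence, so
    they pass from evaluations to \<open>D\<close>.\<close>
  have linear: "linear F" if "F \<in> D" for F
  proof -
    have "closed {F :: ('a \<Rightarrow>\<^sub>L real) \<Rightarrow> real. (\<forall>f g. F (f + g) = F f + F g) \<and> (\<forall>c f. F (c *\<^sub>R f) = c * F f)}"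
      by (intro closed_Collect_all closed_Collect_conj closed_Collect_eq continuous_intros) auto
    then have "D \<subseteq> {F. (\<forall>f g. F (f + g) = F f + F g) \<and> (\<forall>c f. F (c *\<^sub>R f) = c * F f)}"
      unfolding D_def by (rule closure_minimal[rotated])
        (auto simp: \<Phi>_def blinfun.add_left blinfun.scaleR_left)
    with that show ?thesis by (intro linearI) auto
  qed
  have range: "D \<subseteq> range \<Phi>"
  proof
    fix F assume F: "F \<in> D"
    then obtain x where "\<forall>f. F f = blinfun_apply f x"
      using pointwise_closure_hull_is_evaluation[OF K linear[OF F]] by (auto simp: D_def \<Phi>_def[abs_def])
    then have "F = \<Phi> x" by (auto simp: \<Phi>_def)
    then show "F \<in> range \<Phi>" by simp
  qed
  have "inj \<Phi>"
  proof (rule injI)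
    fix x y assume "\<Phi> x = \<Phi> y"
    obtain f :: "'a \<Rightarrow>\<^sub>L real" where "blinfun_apply f (x - y) = norm (x - y)" by (rule norming_functional)
    moreover have "blinfun_apply f x = blinfun_apply f y" using fun_cong[OF \<open>\<Phi> x = \<Phi> y\<close>, of f] by (simp add: \<Phi>_def)
    ultimately show "x = y" by (simp add: blinfun.diff_right)
  qed
  have "continuous_map (top_of_set (range \<Phi>)) weak_top (inv \<Phi>)"
  proof (rule continuous_map_into_weak)
    fix f :: "'a \<Rightarrow> real" assume f: "bounded_linear f"
    have "continuous_on (range \<Phi>) (\<lambda>F. F (Blinfun f))"
      by (rule continuous_on_subset[OF continuous_on_product_coordinates]) auto
    moreover have "F (Blinfun f) = f (inv \<Phi> F)" if "F \<in> range \<Phi>" for F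
      using f_inv_into_f[OF that] by (metis \<Phi>_def bounded_linear_Blinfun_apply[OF f])
    ultimately have "continuous_on (range \<Phi>) (\<lambda>F. f (inv \<Phi> F))" by (simp cong: continuous_on_cong)
    then show "continuous_map (top_of_set (range \<Phi>)) euclideanreal (\<lambda>F. f (inv \<Phi> F))" by simp
  qed
  then have comp: "compactin weak_top (inv \<Phi> ` D)"
    by (rule image_compactin[rotated]) (use compD range in \<open>simp add: compactin_subtopology\<close>)
  have "x \<in> inv \<Phi> ` D" if "x \<in> convex hull K" for x
    using that \<open>inj \<Phi>\<close> closure_subset[of "\<Phi> ` (convex hull K)"]
    by (intro image_eqI[of _ _ "\<Phi> x"]) (auto simp: D_def)
  then have "weak_top closure_of (convex hull K) \<subseteq> inv \<Phi> ` D"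
    by (intro closure_of_minimal compactin_imp_closedin Hausdorff_weak_top comp) auto
  then show ?thesis by (intro closed_compactin[OF comp]) auto
qed

section \<open>Order extreme points\<close>

theorem mainTheorem9:
  fixes T :: "'a::banach_lattice topology"
  assumes "sufficiently_rich T"
  shows "(\<forall>K :: 'a set. K \<subseteq> {x. 0 \<le> x} \<and> compactin T K \<and> compactin T (T closure_of (convex hull K))
              \<longrightarrow> oep (T closure_of (sch K)) \<subseteq> K)
       \<and> (\<forall>K :: 'a set. K \<subseteq> {x. 0 \<le> x} \<and> compactin weak_top K \<longrightarrow> oep (closure (sch K)) \<subseteq> K)
       \<and> (\<forall>K :: 'a set. compact K \<longrightarrow> oep (closure (sch K)) \<subseteq> labs ` K)"
proof (intro conjI allI impI)
  fix K :: "'a set"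
  assume "K \<subseteq> {x. 0 \<le> x} \<and> compactin T K \<and> compactin T (T closure_of (convex hull K))"
  with assms show "oep (T closure_of (sch K)) \<subseteq> K"
    by (intro oep_closure_sch_subset) (auto simp: sufficiently_rich_def)
next
  \<comment> \<open>This is the closure theorem for the weak topology: Krein's theorem supplies
    compactness, Mazur's theorem the weakly closed cone and the equality of closures.\<close>
  have weak: "oep (closure (sch K)) \<subseteq> K" if "K \<subseteq> {x. 0 \<le> x}" "compactin weak_top K" for K :: "'a set"
    using oep_closure_sch_subset[OF lc_hausdorff_weak_top _ that krein[OF that(2)]]
    by (simp add: weak_closure_of_convex convex_sch closedin_weak_convex
        closed_positive_cone convex_positive_cone)
  show "oep (closure (sch K)) \<subseteq> K" if "K \<subseteq> {x. 0 \<le> x} \<and> compactin weak_top K" for K :: "'a set"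
    using that weak by blast
  \<comment> \<open>The image of \<open>K\<close> under the continuous \<open>labs\<close> is norm
    compact, hence weakly compact, and lies in the positive cone.\<close>
  fix K :: "'a set" assume "compact K"
  then have "compact (labs ` K)" by (intro compact_continuous_image continuous_on_labs)
  then have "compactin weak_top ((\<lambda>x. x) ` (labs ` K))"
    by (intro image_compactin[OF _ continuous_map_id_weak]) simp
  then have "oep (closure (sch (labs ` K))) \<subseteq> labs ` K"
    by (intro weak) (auto simp: labs_nonneg)
  then show "oep (closure (sch K)) \<subseteq> labs ` K" by (simp add: sch_labs_image)
qed

end
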